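(* Let $F$ be an algebraically closed field, $G$ a finitely generated group, and $\rho$ a finite-dimensional representation of $G$ over $F$. Then $\rho$ is multiplicity-free if both of the following conditions are satisfied: (i) $\mathrm{End}_G(\rho)$ is commutative; (ii) $\rho$ is a self-injective $F[G]$-module.
   Context: $G$ is regarded as a discrete group. A representation $\rho$ of $G$ over $F$ is multiplicity-free if $\dim_F\mathrm{Hom}_G(\pi,\rho)\le 1$ for all irreducible representations $\pi$ of $G$ over $F$. For a ring $R$ with unity and $R$-modules $M,N$, $M$ is called $N$-injective if for every $R$-module $K$, every injective $R$-module homomorphism $f:K\hookrightarrow N$ and every $R$-module homomorphism $g:K\to M$, there is an $R$-module homomorphism $h:N\to M$ with $h\circ f=g$. $M$ is self-injective if it is $M$-injective. *)

theory Defs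
  imports
    "HOL-Algebra.Generated_Groups"
    "HOL-Algebra.Group_Action"
    "HOL-Algebra.Algebraic_Closure"
    "Jordan_Normal_Form.Missing_VectorSpace"
begin

definition finitely_generated_group :: "('g, 'm) monoid_scheme \<Rightarrow> bool"
  where "finitely_generated_group G \<longleftrightarrow>
    group G \<and> (\<exists>S. finite S \<and> S \<subseteq> carrier G \<and> generate G S = carrier G)"

section \<open>Modules over a ring that need not be commutative\<close>

text \<open>The locale \<^locale>\<open>module\<close> requires a commutative ring of scalars, hence the following
  variant. The set \<^const>\<open>module_hom\<close> of homomorphisms makes sense over any ring.\<close>

locale left_module = R?: ring R + M?: abelian_group M
  for R :: "('r, 'a) ring_scheme" (structure) and M :: "('r, 'm, 'b) module_scheme" (structure) +
  assumes lsmult_closed [simp, intro]: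
      "\<lbrakk>a \<in> carrier R; x \<in> carrier M\<rbrakk> \<Longrightarrow> a \<odot>\<^bsub>M\<^esub> x \<in> carrier M"
    and lsmult_l_distr:
      "\<lbrakk>a \<in> carrier R; b \<in> carrier R; x \<in> carrier M\<rbrakk> \<Longrightarrow>
        (a \<oplus> b) \<odot>\<^bsub>M\<^esub> x = a \<odot>\<^bsub>M\<^esub> x \<oplus>\<^bsub>M\<^esub> b \<odot>\<^bsub>M\<^esub> x"
    and lsmult_r_distr:
      "\<lbrakk>a \<in> carrier R; x \<in> carrier M; y \<in> carrier M\<rbrakk> \<Longrightarrow>
        a \<odot>\<^bsub>M\<^esub> (x \<oplus>\<^bsub>M\<^esub> y) = a \<odot>\<^bsub>M\<^esub> x \<oplus>\<^bsub>M\<^esub> a \<odot>\<^bsub>M\<^esub> y"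
    and lsmult_assoc1:
      "\<lbrakk>a \<in> carrier R; b \<in> carrier R; x \<in> carrier M\<rbrakk> \<Longrightarrow>
        (a \<otimes> b) \<odot>\<^bsub>M\<^esub> x = a \<odot>\<^bsub>M\<^esub> (b \<odot>\<^bsub>M\<^esub> x)"
    and lsmult_one [simp]:
      "x \<in> carrier M \<Longrightarrow> \<one> \<odot>\<^bsub>M\<^esub> x = x"

text \<open>\<open>M\<close> is \<open>N\<close>-injective. The test module \<open>K\<close> ranges over all modules whose elements have the
  same HOL type as those of \<open>N\<close>, as HOL cannot quantify over types inside a formula. Nothing is
  lost, since \<open>K\<close> embeds into \<open>N\<close>: see \<open>injective_relative_toD\<close> below, where the elements
  of \<open>K\<close> may have any type.\<close>

definition injective_relative_to ::
    "('r, 'a) ring_scheme \<Rightarrow> ('r, 'm, 'b) module_scheme \<Rightarrow> ('r, 'n, 'c) module_scheme \<Rightarrow> bool"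
  where "injective_relative_to R M N \<longleftrightarrow>
    (\<forall>(K :: ('r, 'n) module) f g.
      left_module R K \<and> f \<in> module_hom R K N \<and> inj_on f (carrier K) \<and> g \<in> module_hom R K M \<longrightarrow>
        (\<exists>h \<in> module_hom R N M. \<forall>x \<in> carrier K. h (f x) = g x))"

definition self_injective ::
    "('r, 'a) ring_scheme \<Rightarrow> ('r, 'm, 'b) module_scheme \<Rightarrow> bool"
  where "self_injective R M \<longleftrightarrow> injective_relative_to R M M"

lemma injective_relative_toD:
  fixes K :: "('r, 'k, 'd) module_scheme" and N :: "('r, 'n, 'c) module_scheme"
  assumes inj: "injective_relative_to R M N" and N: "left_module R N"
    and K: "left_module R K" and f: "f \<in> module_hom R K N" "inj_on f (carrier K)"
    and g: "g \<in> module_hom R K M"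
  shows "\<exists>h \<in> module_hom R N M. \<forall>x \<in> carrier K. h (f x) = g x"
proof -
  interpret N: left_module R N by fact
  interpret K: left_module R K by fact
  have fc: "f x \<in> carrier N" if "x \<in> carrier K" for x
    using that f(1) by (auto simp: module_hom_def)
  have fa: "f (x \<oplus>\<^bsub>K\<^esub> y) = f x \<oplus>\<^bsub>N\<^esub> f y" if "x \<in> carrier K" "y \<in> carrier K" for x y
    using that f(1) by (auto simp: module_hom_def)
  have fs: "f (r \<odot>\<^bsub>K\<^esub> x) = r \<odot>\<^bsub>N\<^esub> f x" if "r \<in> carrier R" "x \<in> carrier K" for r x
    using that f(1) by (auto simp: module_hom_def)
  have "f \<zero>\<^bsub>K\<^esub> \<oplus>\<^bsub>N\<^esub> f \<zero>\<^bsub>K\<^esub> = f \<zero>\<^bsub>K\<^esub>"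
    using fa[of "\<zero>\<^bsub>K\<^esub>" "\<zero>\<^bsub>K\<^esub>"] by simp
  then have f0: "f \<zero>\<^bsub>K\<^esub> = \<zero>\<^bsub>N\<^esub>"
    using fc[of "\<zero>\<^bsub>K\<^esub>"] by (simp add: N.M.add.l_cancel_one)
  let ?K = "\<lparr>carrier = f ` carrier K, monoid.mult = monoid.mult N, one = one N, zero = zero N,
    add = add N, smult = smult N\<rparr>"
  have "abelian_group ?K"
  proof (rule abelian_groupI)
    show "\<exists>y \<in> carrier ?K. y \<oplus>\<^bsub>?K\<^esub> x = \<zero>\<^bsub>?K\<^esub>" if "x \<in> carrier ?K" for x
    proof -
      from that obtain k where k: "k \<in> carrier K" "x = f k" by auto
      have "f (\<ominus>\<^bsub>K\<^esub> k) \<oplus>\<^bsub>N\<^esub> f k = \<zero>\<^bsub>N\<^esub>"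
        using k(1) fa[of "\<ominus>\<^bsub>K\<^esub> k" k] by (simp add: K.M.l_neg f0)
      then show ?thesis using k by (auto intro!: bexI[of _ "f (\<ominus>\<^bsub>K\<^esub> k)"])
    qed
  qed (auto simp: fc fa[symmetric] f0[symmetric] K.M.a_ac)
  then have K': "left_module R ?K"
    by (intro left_module.intro left_module_axioms.intro N.R.ring_axioms)
       (auto simp: fc fa[symmetric] fs[symmetric] K.lsmult_l_distr K.lsmult_r_distr
          K.lsmult_assoc1)
  define i where "i = inv_into (carrier K) f"
  have i: "i (f x) = x" if "x \<in> carrier K" for x
    using that f(2) by (simp add: i_def)
  have "(\<lambda>x. x) \<in> module_hom R ?K N"
    by (auto simp: module_hom_def fc)
  moreover have "(\<lambda>x. g (i x)) \<in> module_hom R ?K M"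
    using g by (auto simp: module_hom_def i fa[symmetric] fs[symmetric])
  ultimately have "\<exists>h \<in> module_hom R N M. \<forall>x \<in> carrier ?K. h x = g (i x)"
    using inj[unfolded injective_relative_to_def, rule_format, of ?K "\<lambda>x. x" "\<lambda>x. g (i x)"] K'
    by (simp add: inj_on_def)
  then show ?thesis by (auto simp: i)
qed


section \<open>Representations\<close>

text \<open>By \<^locale>\<open>group_action\<close>, \<open>\<rho>\<close> is a homomorphism from \<open>G\<close> to the group of all bijections of
  \<^term>\<open>carrier V\<close>, so with the assumption below it is a homomorphism to \<open>GL(V)\<close>.\<close>

locale group_representation =
  V?: vectorspace F V + action?: group_action G "carrier V" \<rho>
  for F (structure) and G (structure) and V (structure) and \<rho> +
  assumes linear: "g \<in> carrier G \<Longrightarrow> \<rho> g \<in> module_hom F V V"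

definition irreducible_representation ::
    "('f, 'a) ring_scheme \<Rightarrow> ('g, 'b) monoid_scheme \<Rightarrow> ('f, 'v, 'c) module_scheme \<Rightarrow>
     ('g \<Rightarrow> 'v \<Rightarrow> 'v) \<Rightarrow> bool"
  where "irreducible_representation F G V \<rho> \<longleftrightarrow>
    group_representation F G V \<rho> \<and> carrier V \<noteq> {\<zero>\<^bsub>V\<^esub>} \<and>
    (\<forall>W. subspace F W V \<and> (\<forall>g \<in> carrier G. \<rho> g ` W \<subseteq> W) \<longrightarrow> W = {\<zero>\<^bsub>V\<^esub>} \<or> W = carrier V)"

text \<open>Homomorphisms are required to be extensional, so that two of them are equal as soon as they
  agree on \<^term>\<open>carrier V\<close>; otherwise the dimension of the space of homomorphisms would be
  meaningless.\<close>

definition rep_hom ::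
    "('f, 'a) ring_scheme \<Rightarrow> ('g, 'b) monoid_scheme \<Rightarrow>
     ('f, 'v, 'c) module_scheme \<Rightarrow> ('g \<Rightarrow> 'v \<Rightarrow> 'v) \<Rightarrow>
     ('f, 'w, 'd) module_scheme \<Rightarrow> ('g \<Rightarrow> 'w \<Rightarrow> 'w) \<Rightarrow> ('v \<Rightarrow> 'w) set"
  where "rep_hom F G V \<rho> W \<sigma> =
    {f \<in> module_hom F V W \<inter> extensional (carrier V).
      \<forall>g \<in> carrier G. \<forall>v \<in> carrier V. f (\<rho> g v) = \<sigma> g (f v)}"

text \<open>The ring multiplication and unit are fields of the record type of modules that play no
  role for a vector space.\<close>

definition rep_hom_space ::
    "('f, 'a) ring_scheme \<Rightarrow> ('g, 'b) monoid_scheme \<Rightarrow>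
     ('f, 'v, 'c) module_scheme \<Rightarrow> ('g \<Rightarrow> 'v \<Rightarrow> 'v) \<Rightarrow>
     ('f, 'w, 'd) module_scheme \<Rightarrow> ('g \<Rightarrow> 'w \<Rightarrow> 'w) \<Rightarrow> ('f, 'v \<Rightarrow> 'w) module"
  where "rep_hom_space F G V \<rho> W \<sigma> =
    \<lparr>carrier = rep_hom F G V \<rho> W \<sigma>,
     monoid.mult = undefined,
     one = undefined,
     zero = (\<lambda>v \<in> carrier V. \<zero>\<^bsub>W\<^esub>),
     add = (\<lambda>f h. \<lambda>v \<in> carrier V. f v \<oplus>\<^bsub>W\<^esub> h v),
     smult = (\<lambda>a f. \<lambda>v \<in> carrier V. a \<odot>\<^bsub>W\<^esub> f v)\<rparr>"

abbreviation rep_end ::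
    "('f, 'a) ring_scheme \<Rightarrow> ('g, 'b) monoid_scheme \<Rightarrow> ('f, 'v, 'c) module_scheme \<Rightarrow>
     ('g \<Rightarrow> 'v \<Rightarrow> 'v) \<Rightarrow> ('v \<Rightarrow> 'v) set"
  where "rep_end F G V \<rho> \<equiv> rep_hom F G V \<rho> V \<rho>"

text \<open>The type argument is the type of the elements of the irreducible representations
  considered; a theorem that leaves it a type variable covers all irreducible representations.
  The dimension \<^const>\<open>vectorspace.dim\<close> is meaningful only together with
  \<^const>\<open>vectorspace.fin_dim\<close>.\<close>

definition multiplicity_free ::
    "'w itself \<Rightarrow> ('f, 'a) ring_scheme \<Rightarrow> ('g, 'b) monoid_scheme \<Rightarrow>
     ('f, 'v, 'c) module_scheme \<Rightarrow> ('g \<Rightarrow> 'v \<Rightarrow> 'v) \<Rightarrow> bool"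
  where "multiplicity_free T F G V \<rho> \<longleftrightarrow>
    (\<forall>(W :: ('f, 'w) module) \<pi>. irreducible_representation F G W \<pi> \<longrightarrow>
      vectorspace.fin_dim F (rep_hom_space F G W \<pi> V \<rho>) \<and>
      vectorspace.dim F (rep_hom_space F G W \<pi> V \<rho>) \<le> 1)"


section \<open>The group algebra\<close>

definition gsupp :: "('f, 'a) ring_scheme \<Rightarrow> ('g, 'b) monoid_scheme \<Rightarrow> ('g \<Rightarrow> 'f) \<Rightarrow> 'g set"
  where "gsupp F G a = {g \<in> carrier G. a g \<noteq> \<zero>\<^bsub>F\<^esub>}"

text \<open>An element \<open>a\<close> of \<open>F[G]\<close> stands for the formal sum of all \<open>a(g) g\<close>, and the
  multiplication is convolution.\<close>

definition group_algebra ::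
    "('f, 'a) ring_scheme \<Rightarrow> ('g, 'b) monoid_scheme \<Rightarrow> ('g \<Rightarrow> 'f) ring"
  where "group_algebra F G =
    \<lparr>carrier = {a \<in> carrier G \<rightarrow>\<^sub>E carrier F. finite (gsupp F G a)},
     monoid.mult = (\<lambda>a b. \<lambda>x \<in> carrier G.
       \<Oplus>\<^bsub>F\<^esub>y \<in> gsupp F G a. a y \<otimes>\<^bsub>F\<^esub> b (inv\<^bsub>G\<^esub> y \<otimes>\<^bsub>G\<^esub> x)),
     one = (\<lambda>x \<in> carrier G. if x = \<one>\<^bsub>G\<^esub> then \<one>\<^bsub>F\<^esub> else \<zero>\<^bsub>F\<^esub>),
     zero = (\<lambda>x \<in> carrier G. \<zero>\<^bsub>F\<^esub>),
     add = (\<lambda>a b. \<lambda>x \<in> carrier G. a x \<oplus>\<^bsub>F\<^esub> b x)\<rparr>"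

text \<open>The \<open>F[G]\<close>-module attached to a representation.\<close>

definition rep_module ::
    "('f, 'a) ring_scheme \<Rightarrow> ('g, 'b) monoid_scheme \<Rightarrow> ('f, 'v, 'c) module_scheme \<Rightarrow>
     ('g \<Rightarrow> 'v \<Rightarrow> 'v) \<Rightarrow> ('g \<Rightarrow> 'f, 'v) module"
  where "rep_module F G V \<rho> =
    \<lparr>carrier = carrier V,
     monoid.mult = monoid.mult V,
     one = one V,
     zero = zero V,
     add = add V,
     smult = (\<lambda>a v. \<Oplus>\<^bsub>V\<^esub>g \<in> gsupp F G a. a g \<odot>\<^bsub>V\<^esub> \<rho> g v)\<rparr>"


subsection \<open>The group algebra is a ring, and \<^const>\<open>rep_module\<close> is a module over it\<close>

lemma gsupp_subset: "gsupp F G a \<subseteq> carrier G"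
  by (auto simp: gsupp_def)

lemma finsum_gsupp:
  assumes "module F M" "finite S" "gsupp F G a \<subseteq> S" "S \<subseteq> carrier G"
    and "a \<in> carrier G \<rightarrow> carrier F" and u: "u \<in> carrier G \<rightarrow> carrier M"
  shows "(\<Oplus>\<^bsub>M\<^esub>y \<in> gsupp F G a. a y \<odot>\<^bsub>M\<^esub> u y) = (\<Oplus>\<^bsub>M\<^esub>y \<in> S. a y \<odot>\<^bsub>M\<^esub> u y)"
proof -
  interpret module F M by fact
  show ?thesis
    using assms(2-) by (intro M.add.finprod_mono_neutral_cong_left) (auto simp: gsupp_def Pi_def subset_iff)
qed

lemma smult_module:
  assumes "cring F"
  shows "module F \<lparr>carrier = carrier F, monoid.mult = monoid.mult F, one = one F, zero = zero F,
    add = add F, smult = monoid.mult F\<rparr>" (is "module F ?M")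
  and "finsum \<lparr>carrier = carrier F, monoid.mult = monoid.mult F, one = one F, zero = zero F,
    add = add F, smult = monoid.mult F\<rparr> = finsum F"
proof -
  interpret cring F by fact
  have "abelian_group ?M"
    by (rule abelian_groupI) (auto simp: a_ac intro: exI[of _ "a_inv F _"] bexI[of _ "a_inv F _"] l_neg)
  then show "module F ?M"
    by (intro module.intro module_axioms.intro) (auto simp: l_distr r_distr m_ac assms)
  show "finsum ?M = finsum F"
    by (simp add: fun_eq_iff finsum_def finprod_def)
qed

abbreviation gsum where
  "gsum F G M a u \<equiv> (\<Oplus>\<^bsub>M\<^esub>y \<in> gsupp F G a. a y \<odot>\<^bsub>M\<^esub> u y)"

lemma group_algebra_carrierD:
  assumes "a \<in> carrier (group_algebra F G)"
  shows "a \<in> carrier G \<rightarrow> carrier F" "finite (gsupp F G a)" "a \<in> extensional (carrier G)"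
  using assms by (auto simp: group_algebra_def PiE_def)

lemma (in module) gsum_closed:
  assumes "a \<in> carrier G \<rightarrow> carrier R" "u \<in> carrier G \<rightarrow> carrier M"
  shows "gsum R G M a u \<in> carrier M"
  using assms by (intro M.finsum_closed) (auto simp: gsupp_def)

lemma (in module) gsum_add_right:
  assumes "a \<in> carrier G \<rightarrow> carrier R" "u \<in> carrier G \<rightarrow> carrier M" "v \<in> carrier G \<rightarrow> carrier M"
  shows "gsum R G M a (\<lambda>y. u y \<oplus>\<^bsub>M\<^esub> v y) = gsum R G M a u \<oplus>\<^bsub>M\<^esub> gsum R G M a v"
proof -
  have "gsum R G M a (\<lambda>y. u y \<oplus>\<^bsub>M\<^esub> v y)
      = (\<Oplus>\<^bsub>M\<^esub>y \<in> gsupp R G a. a y \<odot>\<^bsub>M\<^esub> u y \<oplus>\<^bsub>M\<^esub> a y \<odot>\<^bsub>M\<^esub> v y)"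
    using assms by (intro M.finsum_cong') (auto simp: gsupp_def smult_r_distr Pi_def)
  also have "\<dots> = gsum R G M a u \<oplus>\<^bsub>M\<^esub> gsum R G M a v"
    using assms by (intro M.finsum_addf) (auto simp: gsupp_def Pi_def)
  finally show ?thesis .
qed

lemma (in module) group_algebra_add_closed:
  assumes "a \<in> carrier (group_algebra R G)" "b \<in> carrier (group_algebra R G)"
  shows "a \<oplus>\<^bsub>group_algebra R G\<^esub> b \<in> carrier (group_algebra R G)"
    and "gsupp R G (a \<oplus>\<^bsub>group_algebra R G\<^esub> b) \<subseteq> gsupp R G a \<union> gsupp R G b"
proof -
  show *: "gsupp R G (a \<oplus>\<^bsub>group_algebra R G\<^esub> b) \<subseteq> gsupp R G a \<union> gsupp R G b"
    by (auto simp: gsupp_def group_algebra_def)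
  then have "finite (gsupp R G (a \<oplus>\<^bsub>group_algebra R G\<^esub> b))"
    using assms by (meson finite_UnI finite_subset group_algebra_carrierD(2))
  then show "a \<oplus>\<^bsub>group_algebra R G\<^esub> b \<in> carrier (group_algebra R G)"
    using assms by (auto simp: group_algebra_def)
qed

lemma (in module) gsum_add_left:
  assumes a: "a \<in> carrier (group_algebra R G)" and b: "b \<in> carrier (group_algebra R G)"
    and u: "u \<in> carrier G \<rightarrow> carrier M"
  shows "gsum R G M (a \<oplus>\<^bsub>group_algebra R G\<^esub> b) u = gsum R G M a u \<oplus>\<^bsub>M\<^esub> gsum R G M b u"
proof -
  let ?S = "gsupp R G a \<union> gsupp R G b"
  have S: "finite ?S" "?S \<subseteq> carrier G"
    using a b by (auto dest: group_algebra_carrierD simp: gsupp_def)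
  note a' = group_algebra_carrierD[OF a] and b' = group_algebra_carrierD[OF b]
  note ab = group_algebra_add_closed[OF a b]
  have "gsum R G M (a \<oplus>\<^bsub>group_algebra R G\<^esub> b) u
      = (\<Oplus>\<^bsub>M\<^esub>y \<in> ?S. (a \<oplus>\<^bsub>group_algebra R G\<^esub> b) y \<odot>\<^bsub>M\<^esub> u y)"
    using S ab group_algebra_carrierD[OF ab(1)] u by (intro finsum_gsupp[OF module_axioms]) auto
  also have "\<dots> = (\<Oplus>\<^bsub>M\<^esub>y \<in> ?S. a y \<odot>\<^bsub>M\<^esub> u y \<oplus>\<^bsub>M\<^esub> b y \<odot>\<^bsub>M\<^esub> u y)"
    using S a'(1) b'(1) u
    by (intro M.finsum_cong') (auto simp: group_algebra_def smult_l_distr Pi_def subset_iff)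
  also have "\<dots> = (\<Oplus>\<^bsub>M\<^esub>y \<in> ?S. a y \<odot>\<^bsub>M\<^esub> u y) \<oplus>\<^bsub>M\<^esub> (\<Oplus>\<^bsub>M\<^esub>y \<in> ?S. b y \<odot>\<^bsub>M\<^esub> u y)"
    using S a'(1) b'(1) u by (intro M.finsum_addf) (auto simp: Pi_def subset_iff)
  also have "(\<Oplus>\<^bsub>M\<^esub>y \<in> ?S. a y \<odot>\<^bsub>M\<^esub> u y) = gsum R G M a u"
    using S a'(1) u by (intro finsum_gsupp[OF module_axioms, symmetric]) auto
  also have "(\<Oplus>\<^bsub>M\<^esub>y \<in> ?S. b y \<odot>\<^bsub>M\<^esub> u y) = gsum R G M b u"
    using S b'(1) u by (intro finsum_gsupp[OF module_axioms, symmetric]) auto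
  finally show ?thesis .
qed

lemma (in module) group_algebra_one_closed:
  assumes "group G"
  shows "\<one>\<^bsub>group_algebra R G\<^esub> \<in> carrier (group_algebra R G)"
proof -
  interpret G: group G by fact
  have "gsupp R G \<one>\<^bsub>group_algebra R G\<^esub> \<subseteq> {\<one>\<^bsub>G\<^esub>}"
    by (auto simp: gsupp_def group_algebra_def)
  then have "finite (gsupp R G \<one>\<^bsub>group_algebra R G\<^esub>)"
    by (rule finite_subset) simp
  then show ?thesis
    by (auto simp: group_algebra_def)
qed

lemma (in module) gsum_one:
  assumes "group G" and u: "u \<in> carrier G \<rightarrow> carrier M"
  shows "gsum R G M \<one>\<^bsub>group_algebra R G\<^esub> u = u \<one>\<^bsub>G\<^esub>"
proof -
  interpret G: group G by fact
  have "gsum R G M \<one>\<^bsub>group_algebra R G\<^esub> u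
      = (\<Oplus>\<^bsub>M\<^esub>y \<in> {\<one>\<^bsub>G\<^esub>}. \<one>\<^bsub>group_algebra R G\<^esub> y \<odot>\<^bsub>M\<^esub> u y)"
    using u by (intro finsum_gsupp[OF module_axioms]) (auto simp: gsupp_def group_algebra_def)
  also have "\<dots> = u \<one>\<^bsub>G\<^esub>"
    using u by (subst M.finsum_insert) (auto simp: group_algebra_def Pi_def)
  finally show ?thesis .
qed

lemma (in module) group_algebra_mult_closed:
  assumes "group G"
    and a: "a \<in> carrier (group_algebra R G)" and b: "b \<in> carrier (group_algebra R G)"
  shows "a \<otimes>\<^bsub>group_algebra R G\<^esub> b \<in> carrier (group_algebra R G)"
    and "gsupp R G (a \<otimes>\<^bsub>group_algebra R G\<^esub> b)
         \<subseteq> (\<lambda>(z, w). z \<otimes>\<^bsub>G\<^esub> w) ` (gsupp R G a \<times> gsupp R G b)"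
proof -
  interpret G: group G by fact
  note a' = group_algebra_carrierD[OF a] and b' = group_algebra_carrierD[OF b]
  show *: "gsupp R G (a \<otimes>\<^bsub>group_algebra R G\<^esub> b)
         \<subseteq> (\<lambda>(z, w). z \<otimes>\<^bsub>G\<^esub> w) ` (gsupp R G a \<times> gsupp R G b)"
  proof (rule subsetI, rule ccontr)
    fix x assume x: "x \<in> gsupp R G (a \<otimes>\<^bsub>group_algebra R G\<^esub> b)"
      and nx: "x \<notin> (\<lambda>(z, w). z \<otimes>\<^bsub>G\<^esub> w) ` (gsupp R G a \<times> gsupp R G b)"
    from x have xG: "x \<in> carrier G" by (simp add: gsupp_def)
    have 0: "b (inv\<^bsub>G\<^esub> y \<otimes>\<^bsub>G\<^esub> x) = \<zero>\<^bsub>R\<^esub>" if y: "y \<in> gsupp R G a" for y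
    proof (rule ccontr)
      assume "b (inv\<^bsub>G\<^esub> y \<otimes>\<^bsub>G\<^esub> x) \<noteq> \<zero>\<^bsub>R\<^esub>"
      moreover have yG: "y \<in> carrier G" using y by (simp add: gsupp_def)
      ultimately have "inv\<^bsub>G\<^esub> y \<otimes>\<^bsub>G\<^esub> x \<in> gsupp R G b"
        using xG by (simp add: gsupp_def)
      moreover have "x = y \<otimes>\<^bsub>G\<^esub> (inv\<^bsub>G\<^esub> y \<otimes>\<^bsub>G\<^esub> x)"
        using xG yG by (simp add: G.m_assoc[symmetric])
      ultimately show False
        using nx y by force
    qed
    have "(a \<otimes>\<^bsub>group_algebra R G\<^esub> b) x
        = (\<Oplus>\<^bsub>R\<^esub>y \<in> gsupp R G a. a y \<otimes>\<^bsub>R\<^esub> b (inv\<^bsub>G\<^esub> y \<otimes>\<^bsub>G\<^esub> x))"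
      using xG by (simp add: group_algebra_def)
    also have "\<dots> = (\<Oplus>\<^bsub>R\<^esub>y \<in> gsupp R G a. \<zero>\<^bsub>R\<^esub>)"
      using a'(1) 0 by (intro R.finsum_cong') (auto simp: gsupp_def Pi_def)
    also have "\<dots> = \<zero>\<^bsub>R\<^esub>" by simp
    finally show False using x by (simp add: gsupp_def)
  qed
  have "finite (gsupp R G (a \<otimes>\<^bsub>group_algebra R G\<^esub> b))"
    by (rule finite_subset[OF *]) (use a' b' in auto)
  moreover have "(\<Oplus>\<^bsub>R\<^esub>y \<in> gsupp R G a. a y \<otimes>\<^bsub>R\<^esub> b (inv\<^bsub>G\<^esub> y \<otimes>\<^bsub>G\<^esub> x)) \<in> carrier R"
    if "x \<in> carrier G" for x
    using that a'(1) b'(1) by (intro R.finsum_closed) (auto simp: gsupp_def Pi_def)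
  ultimately show "a \<otimes>\<^bsub>group_algebra R G\<^esub> b \<in> carrier (group_algebra R G)"
    by (auto simp: group_algebra_def)
qed

lemma (in module) gsum_mult:
  assumes "group G"
    and a: "a \<in> carrier (group_algebra R G)" and b: "b \<in> carrier (group_algebra R G)"
    and u: "u \<in> carrier G \<rightarrow> carrier M"
  shows "gsum R G M (a \<otimes>\<^bsub>group_algebra R G\<^esub> b) u
       = gsum R G M a (\<lambda>z. gsum R G M b (\<lambda>w. u (z \<otimes>\<^bsub>G\<^esub> w)))"
proof -
  interpret G: group G by fact
  note a' = group_algebra_carrierD[OF a] and b' = group_algebra_carrierD[OF b]
  note ab = group_algebra_mult_closed[OF assms(1) a b]
  let ?A = "gsupp R G a" and ?B = "gsupp R G b"
  let ?S = "(\<lambda>(z, w). z \<otimes>\<^bsub>G\<^esub> w) ` (?A \<times> ?B)"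
  have S: "finite ?S" "?S \<subseteq> carrier G"
    using a'(2) b'(2) by (auto simp: gsupp_def)
  have cA: "a z \<in> carrier R" "z \<in> carrier G" if "z \<in> ?A" for z
    using that a'(1) by (auto simp: gsupp_def)
  have cb: "b w \<in> carrier R" if "w \<in> carrier G" for w using that b'(1) by auto
  have cu: "u w \<in> carrier M" if "w \<in> carrier G" for w using that u by auto
  have cS: "y \<in> carrier G" if "y \<in> ?S" for y using that S(2) by blast
  have inner: "(\<Oplus>\<^bsub>M\<^esub>y \<in> ?S. b (inv\<^bsub>G\<^esub> z \<otimes>\<^bsub>G\<^esub> y) \<odot>\<^bsub>M\<^esub> u y) = gsum R G M b (\<lambda>w. u (z \<otimes>\<^bsub>G\<^esub> w))"
    if z: "z \<in> ?A" for z
  proof -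
    note zG = cA(2)[OF z]
    let ?T = "(\<lambda>y. inv\<^bsub>G\<^esub> z \<otimes>\<^bsub>G\<^esub> y) ` ?S"
    have T: "finite ?T" "?T \<subseteq> carrier G" using S(1) cS zG by auto
    have BT: "?B \<subseteq> ?T"
    proof
      fix w assume w: "w \<in> ?B"
      then have "w = inv\<^bsub>G\<^esub> z \<otimes>\<^bsub>G\<^esub> (z \<otimes>\<^bsub>G\<^esub> w)"
        using zG by (simp add: G.m_assoc[symmetric] gsupp_def)
      then show "w \<in> ?T" using w z by blast
    qed
    have canc: "z \<otimes>\<^bsub>G\<^esub> (inv\<^bsub>G\<^esub> z \<otimes>\<^bsub>G\<^esub> y) = y" if "y \<in> carrier G" for y
      using that zG by (simp add: G.m_assoc[symmetric])
    have "gsum R G M b (\<lambda>w. u (z \<otimes>\<^bsub>G\<^esub> w)) = (\<Oplus>\<^bsub>M\<^esub>w \<in> ?T. b w \<odot>\<^bsub>M\<^esub> u (z \<otimes>\<^bsub>G\<^esub> w))"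
      using T BT b'(1) cu zG by (intro finsum_gsupp[OF module_axioms]) auto
    also have "\<dots> = (\<Oplus>\<^bsub>M\<^esub>y \<in> ?S. b (inv\<^bsub>G\<^esub> z \<otimes>\<^bsub>G\<^esub> y) \<odot>\<^bsub>M\<^esub> u (z \<otimes>\<^bsub>G\<^esub> (inv\<^bsub>G\<^esub> z \<otimes>\<^bsub>G\<^esub> y)))"
    proof (rule M.finsum_reindex)
      show "(\<lambda>w. b w \<odot>\<^bsub>M\<^esub> u (z \<otimes>\<^bsub>G\<^esub> w)) \<in> ?T \<rightarrow> carrier M"
        using T(2) cb cu zG by (blast intro!: smult_closed G.m_closed)
      show "inj_on (\<lambda>y. inv\<^bsub>G\<^esub> z \<otimes>\<^bsub>G\<^esub> y) ?S"
        using cS zG by (intro inj_onI) (metis canc)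
    qed
    also have "\<dots> = (\<Oplus>\<^bsub>M\<^esub>y \<in> ?S. b (inv\<^bsub>G\<^esub> z \<otimes>\<^bsub>G\<^esub> y) \<odot>\<^bsub>M\<^esub> u y)"
    proof (rule M.finsum_cong')
      show "b (inv\<^bsub>G\<^esub> z \<otimes>\<^bsub>G\<^esub> y) \<odot>\<^bsub>M\<^esub> u (z \<otimes>\<^bsub>G\<^esub> (inv\<^bsub>G\<^esub> z \<otimes>\<^bsub>G\<^esub> y))
          = b (inv\<^bsub>G\<^esub> z \<otimes>\<^bsub>G\<^esub> y) \<odot>\<^bsub>M\<^esub> u y" if "y \<in> ?S" for y
        using cS[OF that] by (simp add: canc)
      show "(\<lambda>y. b (inv\<^bsub>G\<^esub> z \<otimes>\<^bsub>G\<^esub> y) \<odot>\<^bsub>M\<^esub> u y) \<in> ?S \<rightarrow> carrier M"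
        using cS cb cu zG by (intro funcsetI smult_closed) auto
    qed simp
    finally show ?thesis ..
  qed
  have "gsum R G M (a \<otimes>\<^bsub>group_algebra R G\<^esub> b) u
      = (\<Oplus>\<^bsub>M\<^esub>y \<in> ?S. (a \<otimes>\<^bsub>group_algebra R G\<^esub> b) y \<odot>\<^bsub>M\<^esub> u y)"
    using S ab group_algebra_carrierD[OF ab(1)] u by (intro finsum_gsupp[OF module_axioms])
  also have "\<dots> = (\<Oplus>\<^bsub>M\<^esub>y \<in> ?S. \<Oplus>\<^bsub>M\<^esub>z \<in> ?A. a z \<odot>\<^bsub>M\<^esub> (b (inv\<^bsub>G\<^esub> z \<otimes>\<^bsub>G\<^esub> y) \<odot>\<^bsub>M\<^esub> u y))"
  proof (rule M.finsum_cong')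
    fix y assume "y \<in> ?S"
    note yG = cS[OF this]
    have "(a \<otimes>\<^bsub>group_algebra R G\<^esub> b) y \<odot>\<^bsub>M\<^esub> u y
        = (\<Oplus>\<^bsub>R\<^esub>z \<in> ?A. a z \<otimes>\<^bsub>R\<^esub> b (inv\<^bsub>G\<^esub> z \<otimes>\<^bsub>G\<^esub> y)) \<odot>\<^bsub>M\<^esub> u y"
      using yG by (simp add: group_algebra_def)
    also have "\<dots> = (\<Oplus>\<^bsub>M\<^esub>z \<in> ?A. (a z \<otimes>\<^bsub>R\<^esub> b (inv\<^bsub>G\<^esub> z \<otimes>\<^bsub>G\<^esub> y)) \<odot>\<^bsub>M\<^esub> u y)"
      using a'(2) cA cb cu yG by (intro finsum_smult_r) auto
    also have "\<dots> = (\<Oplus>\<^bsub>M\<^esub>z \<in> ?A. a z \<odot>\<^bsub>M\<^esub> (b (inv\<^bsub>G\<^esub> z \<otimes>\<^bsub>G\<^esub> y) \<odot>\<^bsub>M\<^esub> u y))"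
      using cA cb cu yG by (intro M.finsum_cong') (auto simp: smult_assoc1)
    finally show "(a \<otimes>\<^bsub>group_algebra R G\<^esub> b) y \<odot>\<^bsub>M\<^esub> u y
        = (\<Oplus>\<^bsub>M\<^esub>z \<in> ?A. a z \<odot>\<^bsub>M\<^esub> (b (inv\<^bsub>G\<^esub> z \<otimes>\<^bsub>G\<^esub> y) \<odot>\<^bsub>M\<^esub> u y))" .
  next
    show "(\<lambda>y. \<Oplus>\<^bsub>M\<^esub>z \<in> ?A. a z \<odot>\<^bsub>M\<^esub> (b (inv\<^bsub>G\<^esub> z \<otimes>\<^bsub>G\<^esub> y) \<odot>\<^bsub>M\<^esub> u y)) \<in> ?S \<rightarrow> carrier M"
      using cA cb cu cS by (intro funcsetI M.finsum_closed smult_closed) auto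
  qed simp
  also have "\<dots> = (\<Oplus>\<^bsub>M\<^esub>z \<in> ?A. \<Oplus>\<^bsub>M\<^esub>y \<in> ?S. a z \<odot>\<^bsub>M\<^esub> (b (inv\<^bsub>G\<^esub> z \<otimes>\<^bsub>G\<^esub> y) \<odot>\<^bsub>M\<^esub> u y))"
    using cA cb cu cS a'(2) S(1) by (intro M.add.finprod_finprod_swap smult_closed) auto
  also have "\<dots> = gsum R G M a (\<lambda>z. gsum R G M b (\<lambda>w. u (z \<otimes>\<^bsub>G\<^esub> w)))"
  proof (rule M.finsum_cong')
    fix z assume z: "z \<in> ?A"
    have "(\<Oplus>\<^bsub>M\<^esub>y \<in> ?S. a z \<odot>\<^bsub>M\<^esub> (b (inv\<^bsub>G\<^esub> z \<otimes>\<^bsub>G\<^esub> y) \<odot>\<^bsub>M\<^esub> u y))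
        = a z \<odot>\<^bsub>M\<^esub> (\<Oplus>\<^bsub>M\<^esub>y \<in> ?S. b (inv\<^bsub>G\<^esub> z \<otimes>\<^bsub>G\<^esub> y) \<odot>\<^bsub>M\<^esub> u y)"
      using S(1) cA[OF z] cb cu cS by (intro finsum_smult_ldistr[symmetric] funcsetI smult_closed) auto
    then show "(\<Oplus>\<^bsub>M\<^esub>y \<in> ?S. a z \<odot>\<^bsub>M\<^esub> (b (inv\<^bsub>G\<^esub> z \<otimes>\<^bsub>G\<^esub> y) \<odot>\<^bsub>M\<^esub> u y))
        = a z \<odot>\<^bsub>M\<^esub> gsum R G M b (\<lambda>w. u (z \<otimes>\<^bsub>G\<^esub> w))"
      by (simp only: inner[OF z])
  next
    show "(\<lambda>z. a z \<odot>\<^bsub>M\<^esub> gsum R G M b (\<lambda>w. u (z \<otimes>\<^bsub>G\<^esub> w))) \<in> ?A \<rightarrow> carrier M"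
      using cA b'(1) cu by (intro funcsetI smult_closed gsum_closed) auto
  qed simp
  finally show ?thesis .
qed

lemma ring_group_algebra:
  assumes "cring F" "group G"
  shows "ring (group_algebra F G)"
proof -
  interpret F: cring F by fact
  interpret G: group G by fact
  let ?M = "\<lparr>carrier = carrier F, monoid.mult = monoid.mult F, one = one F, zero = zero F,
    add = add F, smult = monoid.mult F\<rparr>"
  interpret M: module F ?M using smult_module(1) assms(1) .
  note fs = smult_module(2)[OF assms(1)]
  let ?A = "group_algebra F G"
  note D = group_algebra_carrierD
  have mult: "(a \<otimes>\<^bsub>?A\<^esub> b) x = gsum F G ?M a (\<lambda>y. b (inv\<^bsub>G\<^esub> y \<otimes>\<^bsub>G\<^esub> x))" if "x \<in> carrier G" for a b x
    unfolding fs using that by (simp add: group_algebra_def)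
  have eqI: "a = b" if "a \<in> carrier ?A" "b \<in> carrier ?A" "\<And>x. x \<in> carrier G \<Longrightarrow> a x = b x" for a b
    using D(3)[OF that(1)] D(3)[OF that(2)] that(3) by (rule extensionalityI)
  note addc = M.group_algebra_add_closed(1)
  note multc = M.group_algebra_mult_closed(1)[OF assms(2)]
  note onec = M.group_algebra_one_closed[OF assms(2)]
  have addx: "(a \<oplus>\<^bsub>?A\<^esub> b) x = a x \<oplus>\<^bsub>F\<^esub> b x" if "x \<in> carrier G" for a b x
    using that by (simp add: group_algebra_def)
  have zeroc: "\<zero>\<^bsub>?A\<^esub> \<in> carrier ?A"
    by (auto simp: group_algebra_def gsupp_def)
  have zerox: "\<zero>\<^bsub>?A\<^esub> x = \<zero>\<^bsub>F\<^esub>" if "x \<in> carrier G" for x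
    using that by (simp add: group_algebra_def)
  have c: "a x \<in> carrier F" if "a \<in> carrier ?A" "x \<in> carrier G" for a x
    using D(1)[OF that(1)] that(2) by auto
  show ?thesis
  proof (rule ringI)
    show "abelian_group ?A"
    proof (rule abelian_groupI)
      fix a b d assume abd: "a \<in> carrier ?A" "b \<in> carrier ?A" "d \<in> carrier ?A"
      show "a \<oplus>\<^bsub>?A\<^esub> b \<oplus>\<^bsub>?A\<^esub> d = a \<oplus>\<^bsub>?A\<^esub> (b \<oplus>\<^bsub>?A\<^esub> d)"
        by (rule eqI) (use abd in \<open>auto intro: addc simp: addx c F.a_assoc\<close>)
    next
      fix a b assume ab: "a \<in> carrier ?A" "b \<in> carrier ?A"
      show "a \<oplus>\<^bsub>?A\<^esub> b \<in> carrier ?A" using ab by (rule addc)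
      show "a \<oplus>\<^bsub>?A\<^esub> b = b \<oplus>\<^bsub>?A\<^esub> a"
        by (rule eqI) (use ab in \<open>auto intro: addc simp: addx c F.a_comm\<close>)
    next
      fix a assume a: "a \<in> carrier ?A"
      show "\<zero>\<^bsub>?A\<^esub> \<oplus>\<^bsub>?A\<^esub> a = a"
        by (rule eqI) (use a in \<open>auto intro: addc zeroc simp: addx zerox c\<close>)
      let ?n = "\<lambda>x \<in> carrier G. \<ominus>\<^bsub>F\<^esub> a x"
      have "gsupp F G ?n \<subseteq> gsupp F G a"
        by (auto simp: gsupp_def)
      then have "finite (gsupp F G ?n)"
        by (rule finite_subset) (rule D(2)[OF a])
      then have n: "?n \<in> carrier ?A"
        using c[OF a] by (auto simp: group_algebra_def)
      have "?n \<oplus>\<^bsub>?A\<^esub> a = \<zero>\<^bsub>?A\<^esub>"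
        by (rule eqI) (use a n in \<open>auto intro: addc zeroc simp: addx zerox c F.l_neg\<close>)
      with n show "\<exists>y \<in> carrier ?A. y \<oplus>\<^bsub>?A\<^esub> a = \<zero>\<^bsub>?A\<^esub>" by blast
    qed (rule zeroc)
    show "monoid ?A"
    proof (rule monoidI)
      fix a b d assume abd: "a \<in> carrier ?A" "b \<in> carrier ?A" "d \<in> carrier ?A"
      show "a \<otimes>\<^bsub>?A\<^esub> b \<otimes>\<^bsub>?A\<^esub> d = a \<otimes>\<^bsub>?A\<^esub> (b \<otimes>\<^bsub>?A\<^esub> d)"
      proof (rule eqI)
        fix x assume x: "x \<in> carrier G"
        have "(a \<otimes>\<^bsub>?A\<^esub> b \<otimes>\<^bsub>?A\<^esub> d) x
            = gsum F G ?M a (\<lambda>z. gsum F G ?M b (\<lambda>w. d (inv\<^bsub>G\<^esub> (z \<otimes>\<^bsub>G\<^esub> w) \<otimes>\<^bsub>G\<^esub> x)))"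
          unfolding mult[OF x] using abd x
          by (intro M.gsum_mult[OF assms(2)]) (auto simp: c)
        also have "\<dots> = gsum F G ?M a (\<lambda>z. (b \<otimes>\<^bsub>?A\<^esub> d) (inv\<^bsub>G\<^esub> z \<otimes>\<^bsub>G\<^esub> x))"
        proof (rule M.finsum_cong')
          fix z assume z: "z \<in> gsupp F G a"
          then have zG: "z \<in> carrier G" by (simp add: gsupp_def)
          have "gsum F G ?M b (\<lambda>w. d (inv\<^bsub>G\<^esub> (z \<otimes>\<^bsub>G\<^esub> w) \<otimes>\<^bsub>G\<^esub> x))
              = gsum F G ?M b (\<lambda>w. d (inv\<^bsub>G\<^esub> w \<otimes>\<^bsub>G\<^esub> (inv\<^bsub>G\<^esub> z \<otimes>\<^bsub>G\<^esub> x)))"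
            using zG x abd
            by (intro M.finsum_cong')
               (auto simp: gsupp_def G.inv_mult_group G.m_assoc c)
          also have "\<dots> = (b \<otimes>\<^bsub>?A\<^esub> d) (inv\<^bsub>G\<^esub> z \<otimes>\<^bsub>G\<^esub> x)"
            using zG x by (simp only: mult G.m_closed G.inv_closed)
          finally show "a z \<odot>\<^bsub>?M\<^esub> gsum F G ?M b (\<lambda>w. d (inv\<^bsub>G\<^esub> (z \<otimes>\<^bsub>G\<^esub> w) \<otimes>\<^bsub>G\<^esub> x))
              = a z \<odot>\<^bsub>?M\<^esub> (b \<otimes>\<^bsub>?A\<^esub> d) (inv\<^bsub>G\<^esub> z \<otimes>\<^bsub>G\<^esub> x)"
            by (simp only:)
        next
          show "(\<lambda>z. a z \<odot>\<^bsub>?M\<^esub> (b \<otimes>\<^bsub>?A\<^esub> d) (inv\<^bsub>G\<^esub> z \<otimes>\<^bsub>G\<^esub> x)) \<in> gsupp F G a \<rightarrow> carrier ?M"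
            using x abd by (auto simp: gsupp_def c multc)
        qed simp
        also have "\<dots> = (a \<otimes>\<^bsub>?A\<^esub> (b \<otimes>\<^bsub>?A\<^esub> d)) x"
          by (simp only: mult[OF x])
        finally show "(a \<otimes>\<^bsub>?A\<^esub> b \<otimes>\<^bsub>?A\<^esub> d) x = (a \<otimes>\<^bsub>?A\<^esub> (b \<otimes>\<^bsub>?A\<^esub> d)) x" .
      qed (use abd in \<open>auto intro: multc\<close>)
    next
      fix a assume a: "a \<in> carrier ?A"
      show "\<one>\<^bsub>?A\<^esub> \<otimes>\<^bsub>?A\<^esub> a = a"
      proof (rule eqI)
        fix x assume x: "x \<in> carrier G"
        have "(\<one>\<^bsub>?A\<^esub> \<otimes>\<^bsub>?A\<^esub> a) x = a (inv\<^bsub>G\<^esub> \<one>\<^bsub>G\<^esub> \<otimes>\<^bsub>G\<^esub> x)"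
          unfolding mult[OF x] using a x by (intro M.gsum_one[OF assms(2)]) (auto simp: c)
        then show "(\<one>\<^bsub>?A\<^esub> \<otimes>\<^bsub>?A\<^esub> a) x = a x" using x by simp
      qed (use a onec in \<open>auto intro: multc\<close>)
      show "a \<otimes>\<^bsub>?A\<^esub> \<one>\<^bsub>?A\<^esub> = a"
      proof (rule eqI)
        fix x assume x: "x \<in> carrier G"
        let ?S = "insert x (gsupp F G a)"
        have S: "finite ?S" "?S \<subseteq> carrier G" using D(2)[OF a] x by (auto simp: gsupp_def)
        have eq1: "inv\<^bsub>G\<^esub> y \<otimes>\<^bsub>G\<^esub> x = \<one>\<^bsub>G\<^esub> \<longleftrightarrow> x = y" if "y \<in> carrier G" for y
          using that x by (metis G.inv_equality G.inv_inv G.inv_closed G.l_inv)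
        have "(a \<otimes>\<^bsub>?A\<^esub> \<one>\<^bsub>?A\<^esub>) x = (\<Oplus>\<^bsub>?M\<^esub>y \<in> ?S. a y \<odot>\<^bsub>?M\<^esub> \<one>\<^bsub>?A\<^esub> (inv\<^bsub>G\<^esub> y \<otimes>\<^bsub>G\<^esub> x))"
          unfolding mult[OF x] using S a onec x D(1)[OF a]
          by (intro finsum_gsupp[OF M.module_axioms]) (auto simp: c)
        also have "\<dots> = (\<Oplus>\<^bsub>?M\<^esub>y \<in> ?S. if x = y then a y else \<zero>\<^bsub>?M\<^esub>)"
          using S a x
          by (intro M.finsum_cong') (auto simp: group_algebra_def eq1 subset_iff Pi_def PiE_def)
        also have "\<dots> = a x"
          using S a x by (intro M.finsum_singleton) (auto simp: c subset_iff)
        finally show "(a \<otimes>\<^bsub>?A\<^esub> \<one>\<^bsub>?A\<^esub>) x = a x" .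
      qed (use a onec in \<open>auto intro: multc\<close>)
    qed (auto intro: multc onec)
    fix a b d assume abd: "a \<in> carrier ?A" "b \<in> carrier ?A" "d \<in> carrier ?A"
    show "(a \<oplus>\<^bsub>?A\<^esub> b) \<otimes>\<^bsub>?A\<^esub> d = a \<otimes>\<^bsub>?A\<^esub> d \<oplus>\<^bsub>?A\<^esub> b \<otimes>\<^bsub>?A\<^esub> d"
    proof (rule eqI)
      fix x assume x: "x \<in> carrier G"
      have "((a \<oplus>\<^bsub>?A\<^esub> b) \<otimes>\<^bsub>?A\<^esub> d) x = (a \<otimes>\<^bsub>?A\<^esub> d) x \<oplus>\<^bsub>?M\<^esub> (b \<otimes>\<^bsub>?A\<^esub> d) x"
        unfolding mult[OF x] using abd x by (intro M.gsum_add_left) (auto simp: c)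
      then show "((a \<oplus>\<^bsub>?A\<^esub> b) \<otimes>\<^bsub>?A\<^esub> d) x = (a \<otimes>\<^bsub>?A\<^esub> d \<oplus>\<^bsub>?A\<^esub> b \<otimes>\<^bsub>?A\<^esub> d) x"
        using x by (simp add: addx)
    qed (use abd in \<open>auto intro: multc addc\<close>)
    show "d \<otimes>\<^bsub>?A\<^esub> (a \<oplus>\<^bsub>?A\<^esub> b) = d \<otimes>\<^bsub>?A\<^esub> a \<oplus>\<^bsub>?A\<^esub> d \<otimes>\<^bsub>?A\<^esub> b"
    proof (rule eqI)
      fix x assume x: "x \<in> carrier G"
      have "(d \<otimes>\<^bsub>?A\<^esub> (a \<oplus>\<^bsub>?A\<^esub> b)) x
          = gsum F G ?M d (\<lambda>y. a (inv\<^bsub>G\<^esub> y \<otimes>\<^bsub>G\<^esub> x) \<oplus>\<^bsub>?M\<^esub> b (inv\<^bsub>G\<^esub> y \<otimes>\<^bsub>G\<^esub> x))"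
        unfolding mult[OF x] using abd x
        by (intro M.finsum_cong') (auto simp: c addx gsupp_def)
      also have "\<dots> = (d \<otimes>\<^bsub>?A\<^esub> a) x \<oplus>\<^bsub>?M\<^esub> (d \<otimes>\<^bsub>?A\<^esub> b) x"
        unfolding mult[OF x] using abd x by (intro M.gsum_add_right) (auto simp: c)
      finally show "(d \<otimes>\<^bsub>?A\<^esub> (a \<oplus>\<^bsub>?A\<^esub> b)) x = (d \<otimes>\<^bsub>?A\<^esub> a \<oplus>\<^bsub>?A\<^esub> d \<otimes>\<^bsub>?A\<^esub> b) x"
        using x by (simp add: addx)
    qed (use abd in \<open>auto intro: multc addc\<close>)
  qed
qed

context group_representation
begin

lemma rho_closed: "g \<in> carrier G \<Longrightarrow> v \<in> carrier V \<Longrightarrow> \<rho> g v \<in> carrier V"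
  using linear by (auto simp: module_hom_def Pi_def)

lemma rho_add:
  "g \<in> carrier G \<Longrightarrow> v \<in> carrier V \<Longrightarrow> w \<in> carrier V \<Longrightarrow> \<rho> g (v \<oplus>\<^bsub>V\<^esub> w) = \<rho> g v \<oplus>\<^bsub>V\<^esub> \<rho> g w"
  using linear by (auto simp: module_hom_def)

lemma rho_smult:
  "g \<in> carrier G \<Longrightarrow> a \<in> carrier F \<Longrightarrow> v \<in> carrier V \<Longrightarrow> \<rho> g (a \<odot>\<^bsub>V\<^esub> v) = a \<odot>\<^bsub>V\<^esub> \<rho> g v"
  using linear by (auto simp: module_hom_def)

lemma rho_one: "v \<in> carrier V \<Longrightarrow> \<rho> \<one>\<^bsub>G\<^esub> v = v"
  using action.id_eq_one by (metis restrict_apply')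

lemma rho_mult:
  "g \<in> carrier G \<Longrightarrow> h \<in> carrier G \<Longrightarrow> v \<in> carrier V \<Longrightarrow> \<rho> (g \<otimes>\<^bsub>G\<^esub> h) v = \<rho> g (\<rho> h v)"
  using action.composition_rule by metis

lemma rho_finsum:
  assumes "g \<in> carrier G" "finite A" "f \<in> A \<rightarrow> carrier V"
  shows "\<rho> g (\<Oplus>\<^bsub>V\<^esub>i \<in> A. f i) = (\<Oplus>\<^bsub>V\<^esub>i \<in> A. \<rho> g (f i))"
  using assms(2,3)
proof (induction A rule: finite_induct)
  case empty
  have "\<rho> g \<zero>\<^bsub>V\<^esub> \<oplus>\<^bsub>V\<^esub> \<rho> g \<zero>\<^bsub>V\<^esub> = \<rho> g \<zero>\<^bsub>V\<^esub>"
    using rho_add[OF assms(1), of "\<zero>\<^bsub>V\<^esub>" "\<zero>\<^bsub>V\<^esub>"] by simp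
  then show ?case
    using rho_closed[OF assms(1), of "\<zero>\<^bsub>V\<^esub>"] by (simp add: M.add.l_cancel_one)
next
  case (insert x A)
  then show ?case
    using assms(1) by (simp add: rho_add rho_closed Pi_def)
qed

lemma group_G: "group G"
  using action.group_hom by (simp add: group_hom_def)

lemma left_module_rep_module: "left_module (group_algebra F G) (rep_module F G V \<rho>)"
proof -
  interpret G: group G by (rule group_G)
  interpret A: ring "group_algebra F G"
    using ring_group_algebra R.is_cring group_G by blast
  let ?A = "group_algebra F G" and ?N = "rep_module F G V \<rho>"
  note D = group_algebra_carrierD
  have sm: "a \<odot>\<^bsub>?N\<^esub> v = gsum F G V a (\<lambda>g. \<rho> g v)" for a v
    by (simp add: rep_module_def)
  have simps: "carrier ?N = carrier V" "x \<oplus>\<^bsub>?N\<^esub> y = x \<oplus>\<^bsub>V\<^esub> y" "\<zero>\<^bsub>?N\<^esub> = \<zero>\<^bsub>V\<^esub>" for x y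
    by (simp_all add: rep_module_def)
  have N: "abelian_group ?N"
    by (rule abelian_groupI) (auto simp: simps M.a_ac intro: M.add.l_inv_ex)
  show ?thesis
  proof (intro left_module.intro left_module_axioms.intro A.ring_axioms N; unfold simps)
    fix a v assume "a \<in> carrier ?A" "v \<in> carrier V"
    then show "a \<odot>\<^bsub>?N\<^esub> v \<in> carrier V"
      unfolding sm by (intro gsum_closed) (auto dest: D simp: rho_closed)
  next
    fix a b v assume "a \<in> carrier ?A" "b \<in> carrier ?A" "v \<in> carrier V"
    then show "(a \<oplus>\<^bsub>?A\<^esub> b) \<odot>\<^bsub>?N\<^esub> v = a \<odot>\<^bsub>?N\<^esub> v \<oplus>\<^bsub>V\<^esub> b \<odot>\<^bsub>?N\<^esub> v"
      unfolding sm by (intro gsum_add_left) (auto simp: rho_closed)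
  next
    fix a v w assume *: "a \<in> carrier ?A" "v \<in> carrier V" "w \<in> carrier V"
    have "a \<odot>\<^bsub>?N\<^esub> (v \<oplus>\<^bsub>V\<^esub> w) = gsum F G V a (\<lambda>g. \<rho> g v \<oplus>\<^bsub>V\<^esub> \<rho> g w)"
      unfolding sm using * D(1)[OF *(1)]
      by (intro M.finsum_cong') (auto simp: gsupp_def rho_add rho_closed Pi_def)
    also have "\<dots> = a \<odot>\<^bsub>?N\<^esub> v \<oplus>\<^bsub>V\<^esub> a \<odot>\<^bsub>?N\<^esub> w"
      unfolding sm using * D(1)[OF *(1)] by (intro gsum_add_right) (auto simp: rho_closed)
    finally show "a \<odot>\<^bsub>?N\<^esub> (v \<oplus>\<^bsub>V\<^esub> w) = a \<odot>\<^bsub>?N\<^esub> v \<oplus>\<^bsub>V\<^esub> a \<odot>\<^bsub>?N\<^esub> w" .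
  next
    fix a b v assume *: "a \<in> carrier ?A" "b \<in> carrier ?A" "v \<in> carrier V"
    note a' = D[OF *(1)] and b' = D[OF *(2)]
    have "(a \<otimes>\<^bsub>?A\<^esub> b) \<odot>\<^bsub>?N\<^esub> v = gsum F G V a (\<lambda>z. gsum F G V b (\<lambda>w. \<rho> (z \<otimes>\<^bsub>G\<^esub> w) v))"
      unfolding sm using * by (intro gsum_mult[OF group_G]) (auto simp: rho_closed)
    also have "\<dots> = gsum F G V a (\<lambda>z. \<rho> z (b \<odot>\<^bsub>?N\<^esub> v))"
    proof (rule M.finsum_cong')
      fix z assume "z \<in> gsupp F G a"
      then have zG: "z \<in> carrier G" by (simp add: gsupp_def)
      have "\<rho> z (b \<odot>\<^bsub>?N\<^esub> v) = (\<Oplus>\<^bsub>V\<^esub>w \<in> gsupp F G b. \<rho> z (b w \<odot>\<^bsub>V\<^esub> \<rho> w v))"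
        unfolding sm using zG b' * by (intro rho_finsum) (auto simp: gsupp_def rho_closed Pi_def)
      also have "\<dots> = gsum F G V b (\<lambda>w. \<rho> (z \<otimes>\<^bsub>G\<^esub> w) v)"
        using zG b'(1) *
        by (intro M.finsum_cong') (auto simp: gsupp_def rho_closed rho_smult rho_mult Pi_def)
      finally show "a z \<odot>\<^bsub>V\<^esub> gsum F G V b (\<lambda>w. \<rho> (z \<otimes>\<^bsub>G\<^esub> w) v) = a z \<odot>\<^bsub>V\<^esub> \<rho> z (b \<odot>\<^bsub>?N\<^esub> v)"
        by (simp only:)
    next
      show "(\<lambda>z. a z \<odot>\<^bsub>V\<^esub> \<rho> z (b \<odot>\<^bsub>?N\<^esub> v)) \<in> gsupp F G a \<rightarrow> carrier V"
        unfolding sm using a'(1) b'(1) *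
        by (intro funcsetI smult_closed rho_closed gsum_closed) (auto simp: gsupp_def rho_closed)
    qed simp
    also have "\<dots> = a \<odot>\<^bsub>?N\<^esub> (b \<odot>\<^bsub>?N\<^esub> v)"
      by (simp only: sm[of a])
    finally show "(a \<otimes>\<^bsub>?A\<^esub> b) \<odot>\<^bsub>?N\<^esub> v = a \<odot>\<^bsub>?N\<^esub> (b \<odot>\<^bsub>?N\<^esub> v)" .
  next
    fix v assume "v \<in> carrier V"
    then show "\<one>\<^bsub>?A\<^esub> \<odot>\<^bsub>?N\<^esub> v = v"
      unfolding sm by (subst gsum_one[OF group_G]) (auto simp: rho_closed rho_one)
  qed
qed

end

lemma vectorspace_rep_hom_space:
  assumes "group_representation F G V \<rho>" "group_representation F G W \<sigma>"
  shows "vectorspace F (rep_hom_space F G V \<rho> W \<sigma>)"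
proof -
  interpret V: group_representation F G V \<rho> by fact
  interpret W: group_representation F G W \<sigma> by fact
  let ?H = "rep_hom_space F G V \<rho> W \<sigma>"
  have H: "f \<in> carrier ?H \<longleftrightarrow> f \<in> carrier V \<rightarrow>\<^sub>E carrier W
      \<and> (\<forall>v \<in> carrier V. \<forall>w \<in> carrier V. f (v \<oplus>\<^bsub>V\<^esub> w) = f v \<oplus>\<^bsub>W\<^esub> f w)
      \<and> (\<forall>a \<in> carrier F. \<forall>v \<in> carrier V. f (a \<odot>\<^bsub>V\<^esub> v) = a \<odot>\<^bsub>W\<^esub> f v)
      \<and> (\<forall>g \<in> carrier G. \<forall>v \<in> carrier V. f (\<rho> g v) = \<sigma> g (f v))" for f
    by (auto simp: rep_hom_space_def rep_hom_def module_hom_def PiE_def)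
  have c: "f v \<in> carrier W" if "f \<in> carrier ?H" "v \<in> carrier V" for f v
    using that by (auto simp: H)
  have eqI: "f = h" if "f \<in> carrier ?H" "h \<in> carrier ?H" "\<And>v. v \<in> carrier V \<Longrightarrow> f v = h v" for f h
    using that by (intro extensionalityI[of f "carrier V" h]) (auto simp: H PiE_def)
  have ops: "(f \<oplus>\<^bsub>?H\<^esub> h) v = f v \<oplus>\<^bsub>W\<^esub> h v" "(a \<odot>\<^bsub>?H\<^esub> f) v = a \<odot>\<^bsub>W\<^esub> f v" "\<zero>\<^bsub>?H\<^esub> v = \<zero>\<^bsub>W\<^esub>"
    if "v \<in> carrier V" for f h a v
    using that by (simp_all add: rep_hom_space_def)
  have z\<sigma>: "\<sigma> g \<zero>\<^bsub>W\<^esub> = \<zero>\<^bsub>W\<^esub>" if "g \<in> carrier G" for g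
    using W.rho_finsum[OF that, of "{}" "\<lambda>_. \<zero>\<^bsub>W\<^esub>"] by simp
  have zero: "\<zero>\<^bsub>?H\<^esub> \<in> carrier ?H"
    unfolding H by (auto simp: rep_hom_space_def z\<sigma> V.rho_closed)
  have add: "f \<oplus>\<^bsub>?H\<^esub> h \<in> carrier ?H" if "f \<in> carrier ?H" "h \<in> carrier ?H" for f h
  proof -
    have e: "f \<oplus>\<^bsub>?H\<^esub> h \<in> carrier V \<rightarrow>\<^sub>E carrier W"
      using c[OF that(1)] c[OF that(2)] by (auto simp: rep_hom_space_def)
    then show ?thesis
      using that by (subst H) (auto simp: H ops c[OF that(1)] c[OF that(2)] V.rho_closed
          W.M.a_ac W.smult_r_distr W.rho_add)
  qed
  have smult: "a \<odot>\<^bsub>?H\<^esub> f \<in> carrier ?H" if "a \<in> carrier F" "f \<in> carrier ?H" for a f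
  proof -
    have e: "a \<odot>\<^bsub>?H\<^esub> f \<in> carrier V \<rightarrow>\<^sub>E carrier W"
      using that c[OF that(2)] by (auto simp: rep_hom_space_def)
    have "a \<odot>\<^bsub>W\<^esub> (b \<odot>\<^bsub>W\<^esub> f v) = b \<odot>\<^bsub>W\<^esub> (a \<odot>\<^bsub>W\<^esub> f v)" if "b \<in> carrier F" "v \<in> carrier V" for b v
      using that \<open>a \<in> carrier F\<close> c[OF \<open>f \<in> carrier ?H\<close>]
      by (metis W.smult_assoc1 V.R.m_comm)
    with e show ?thesis
      using that by (subst H) (auto simp: H ops c[OF that(2)] V.rho_closed
          W.smult_r_distr W.rho_smult)
  qed
  have "module F ?H"
  proof (rule module_criteria)
    show "\<forall>f \<in> carrier ?H. \<exists>n \<in> carrier ?H. f \<oplus>\<^bsub>?H\<^esub> n = \<zero>\<^bsub>?H\<^esub>"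
    proof
      fix f assume f: "f \<in> carrier ?H"
      have n: "(\<ominus>\<^bsub>F\<^esub> \<one>\<^bsub>F\<^esub>) \<odot>\<^bsub>?H\<^esub> f \<in> carrier ?H" using f by (intro smult) auto
      have "f \<oplus>\<^bsub>?H\<^esub> (\<ominus>\<^bsub>F\<^esub> \<one>\<^bsub>F\<^esub>) \<odot>\<^bsub>?H\<^esub> f = \<zero>\<^bsub>?H\<^esub>"
        by (rule eqI) (use f n in \<open>auto intro: add zero simp: ops c W.smult_l_minus W.M.r_neg\<close>)
      with n show "\<exists>n \<in> carrier ?H. f \<oplus>\<^bsub>?H\<^esub> n = \<zero>\<^bsub>?H\<^esub>" by blast
    qed
  qed (auto intro!: eqI intro: add zero smult V.R.is_cring
        simp: ops c W.M.a_ac W.smult_l_distr W.smult_r_distr W.smult_assoc1)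
  then show ?thesis
    by (intro vectorspace.intro V.field_axioms)
qed

end

theory Submission
  imports Defs
begin

text \<open>Let \<open>W\<close> be irreducible and \<open>H = Hom\<^sub>G(W, V)\<close>. Every nonzero element of \<open>H\<close> is injective, so by
  self-injectivity it generates \<open>H\<close> as a module over \<open>E = End\<^sub>G(V)\<close>. An \<open>h \<in> E\<close> has an eigenvector
  in \<open>H\<close>, since evaluation at a nonzero \<open>w \<in> W\<close> embeds \<open>H\<close> into the finite-dimensional space \<open>V\<close>.
  As \<open>E\<close> is commutative and the eigenvector generates \<open>H\<close>, \<open>h\<close> acts on \<open>H\<close> as a scalar. Hence any
  two nonzero elements of \<open>H\<close> are proportional.\<close>

section \<open>Eigenvectors over an algebraically closed field\<close>

text \<open>Otherwise the first \<open>dim + 1\<close> terms would be distinct and independent. The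
  sum runs over indices, not over a set of vectors, so that it can be read as a polynomial relation
  when \<open>x i\<close> is the \<open>i\<close>-th iterate of a linear map.\<close>

lemma (in vectorspace) sequence_dependent:
  assumes fd: "fin_dim" and x: "\<And>i :: nat. x i \<in> carrier V"
  shows "\<exists>n b. b \<in> UNIV \<rightarrow> carrier K \<and> x n = (\<Oplus>\<^bsub>V\<^esub>i \<in> {..<n}. b i \<odot>\<^bsub>V\<^esub> x i)"
proof -
  have X: "x ` A \<subseteq> carrier V" for A
    using x by auto
  \<comment> \<open>Injectivity is carried along because independence of the image set alone would
    not detect repeated terms.\<close>
  have *: "lin_indpt (x ` {..<n}) \<and> inj_on x {..<n}" if "\<And>m. m < n \<Longrightarrow> x m \<notin> span (x ` {..<m})" for n
    using that
  proof (induction n)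
    case 0
    then show ?case by (simp add: lin_dep_def)
  next
    case (Suc n)
    have IH: "lin_indpt (x ` {..<n})" "inj_on x {..<n}"
      using Suc by auto
    have nin: "x n \<notin> span (x ` {..<n})"
      using Suc.prems by blast
    then have "x n \<notin> x ` {..<n}"
      using in_own_span[OF X] by blast
    with IH nin show ?case
      using lin_dep_iff_in_span[OF X IH(1) x] by (simp add: lessThan_Suc)
  qed
  have "\<exists>n. x n \<in> span (x ` {..<n})"
  proof (rule ccontr)
    assume "\<nexists>n. x n \<in> span (x ` {..<n})"
    then have "lin_indpt (x ` {..<Suc dim})" "inj_on x {..<Suc dim}"
      using * by blast+
    then show False
      using li_le_dim(2)[OF fd X, of "{..<Suc dim}"] by (simp add: card_image)
  qed
  \<comment> \<open>For the least such \<open>n\<close> the earlier terms are distinct, so a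
    combination over their set can be reindexed by \<open>{..<n}\<close>.\<close>
  then obtain n where n: "x n \<in> span (x ` {..<n})" and "\<And>m. m < n \<Longrightarrow> x m \<notin> span (x ` {..<m})"
    using exists_least_iff[of "\<lambda>n. x n \<in> span (x ` {..<n})"] by blast
  with * have inj: "inj_on x {..<n}" by blast
  obtain a where a: "a \<in> x ` {..<n} \<rightarrow> carrier K" "x n = lincomb a (x ` {..<n})"
    using n finite_span[OF _ X, of "{..<n}"] by auto
  \<comment> \<open>The value zero from \<open>n\<close> on keeps \<open>b\<close> inside the field
    on all of \<open>UNIV\<close>.\<close>
  define b where "b i = (if i < n then a (x i) else \<zero>\<^bsub>K\<^esub>)" for i
  have "x n = (\<Oplus>\<^bsub>V\<^esub>i \<in> {..<n}. a (x i) \<odot>\<^bsub>V\<^esub> x i)"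
    unfolding a(2) lincomb_def using a(1) x by (intro M.add.finprod_reindex inj) auto
  also have "\<dots> = (\<Oplus>\<^bsub>V\<^esub>i \<in> {..<n}. b i \<odot>\<^bsub>V\<^esub> x i)"
    using a(1) x by (intro M.finsum_cong') (auto simp: b_def Pi_iff)
  finally show ?thesis
    using a(1) by (intro exI[of _ n] exI[of _ b]) (auto simp: b_def[abs_def] Pi_iff)
qed

section \<open>Polynomials as coefficient lists: roots and Horner's scheme\<close>

text \<open>Horner's rule: \<open>eval\<close> recurses on the leading coefficient, while
  \<open>horner\<close> and the division below are unfolded at the constant term.\<close>

lemma (in ring) eval_snoc:
  assumes "set p \<subseteq> carrier R" "a \<in> carrier R" "c \<in> carrier R"
  shows "eval (p @ [a]) c = eval p c \<otimes> c \<oplus> a"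
  using assms
proof (induction p)
  case (Cons d p)
  then show ?case
    using eval_in_carrier[of p c] by (simp add: l_distr m_assoc a_assoc)
qed simp

text \<open>The polynomial splits, so it has as many roots, with multiplicity, as its degree
  \<open>length p - 1\<close>, which is positive here.\<close>

lemma (in algebraically_closed) exists_root:
  assumes "set p \<subseteq> carrier L" "p \<noteq> []" "hd p \<noteq> \<zero>" "length p \<noteq> 1"
  shows "\<exists>c \<in> carrier L. eval p c = \<zero>"
proof -
  have p: "p \<in> carrier (poly_ring L)"
    using assms by (auto simp: univ_poly_carrier[symmetric] polynomial_def)
  have "size (roots p) = degree p"
    using roots_over_carrier[OF p] by (simp add: splitted_def)
  then have "size (roots p) \<noteq> 0"
    using assms(2,4) by (cases p) auto
  then obtain c where "c \<in># roots p"
    by (metis multiset_nonemptyE size_empty)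
  then show ?thesis
    using roots_mem_iff_is_root[OF p] by (auto simp: is_root_def)
qed

text \<open>For coefficients \<open>p\<close> with the leading one first, \<open>horner V T v p\<close> is \<open>p(T) v\<close>.\<close>

definition horner :: "('f, 'v, 'c) module_scheme \<Rightarrow> ('v \<Rightarrow> 'v) \<Rightarrow> 'v \<Rightarrow> 'f list \<Rightarrow> 'v"
  where "horner V T v = foldl (\<lambda>u a. T u \<oplus>\<^bsub>V\<^esub> a \<odot>\<^bsub>V\<^esub> v) \<zero>\<^bsub>V\<^esub>"

lemma horner_simps [simp]:
  "horner V T v [] = \<zero>\<^bsub>V\<^esub>"
  "horner V T v (p @ [a]) = T (horner V T v p) \<oplus>\<^bsub>V\<^esub> a \<odot>\<^bsub>V\<^esub> v"
  by (simp_all add: horner_def)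

context vectorspace
begin

lemma funpow_closed:
  assumes "T \<in> carrier V \<rightarrow> carrier V" "v \<in> carrier V"
  shows "(T ^^ i) v \<in> carrier V"
  using assms by (induction i) auto

lemma horner_closed:
  assumes "T \<in> module_hom K V V" "v \<in> carrier V" "set p \<subseteq> carrier K"
  shows "horner V T v p \<in> carrier V"
  using assms by (induction p rule: rev_induct) (auto simp: module_hom_def)

text \<open>Division by \<open>X - c\<close> with remainder \<open>p(c)\<close>, that is
  \<open>p = (X - c) q + p(c)\<close>, evaluated at \<open>T\<close> and applied to
  \<open>v\<close>. Both sides are arranged so that no subtraction occurs.\<close>

lemma horner_synthetic_division:
  assumes T: "T \<in> module_hom K V V" and v: "v \<in> carrier V" and c: "c \<in> carrier K"
    and p: "set p \<subseteq> carrier K" "p \<noteq> []"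
  shows "\<exists>q. set q \<subseteq> carrier K \<and> length q = length p - 1 \<and> (q \<noteq> [] \<longrightarrow> hd q = hd p) \<and>
    T (horner V T v q) \<oplus>\<^bsub>V\<^esub> eval p c \<odot>\<^bsub>V\<^esub> v = c \<odot>\<^bsub>V\<^esub> horner V T v q \<oplus>\<^bsub>V\<^esub> horner V T v p"
  using p(2,1)
proof (induction p rule: rev_nonempty_induct)
  case (single a)
  interpret T: mod_hom K V V T by unfold_locales (rule T)
  show ?case
    using single v c by (intro exI[of _ "[]"]) (auto simp: horner_def)
next
  case (snoc a p)
  interpret T: mod_hom K V V T by unfold_locales (rule T)
  from snoc obtain q where q: "set q \<subseteq> carrier K" "length q = length p - 1" "q \<noteq> [] \<longrightarrow> hd q = hd p"
    and eq: "T (horner V T v q) \<oplus>\<^bsub>V\<^esub> eval p c \<odot>\<^bsub>V\<^esub> v = c \<odot>\<^bsub>V\<^esub> horner V T v q \<oplus>\<^bsub>V\<^esub> horner V T v p"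
    by auto
  have a: "a \<in> carrier K" and p: "set p \<subseteq> carrier K"
    using snoc.prems by auto
  let ?r = "eval p c"
  have r: "?r \<in> carrier K"
    using p c by (rule eval_in_carrier)
  let ?h = "horner V T v"
  have hc: "?h q \<in> carrier V" "?h p \<in> carrier V"
    using T v q(1) p by (auto intro: horner_closed)
  show ?case
  \<comment> \<open>The old remainder \<open>?r\<close> becomes the last coefficient of the new
    quotient: \<open>p X + a = (X - c) (q X + r) + (r c + a)\<close>.\<close>
  proof (intro exI[of _ "q @ [?r]"] conjI)
    show "set (q @ [?r]) \<subseteq> carrier K" using q r by auto
    show "length (q @ [?r]) = length (p @ [a]) - 1" using q snoc.hyps by (cases p) auto
    show "q @ [?r] \<noteq> [] \<longrightarrow> hd (q @ [?r]) = hd (p @ [a])"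
    proof (cases q)
      case Nil
      with q(2) snoc.hyps obtain d where "p = [d]" by (cases p) auto
      then show ?thesis using Nil p by simp
    next
      case (Cons d q')
      then show ?thesis using q snoc.hyps by simp
    qed
    have "T (?h (q @ [?r])) \<oplus>\<^bsub>V\<^esub> eval (p @ [a]) c \<odot>\<^bsub>V\<^esub> v
        = T (c \<odot>\<^bsub>V\<^esub> ?h q \<oplus>\<^bsub>V\<^esub> ?h p) \<oplus>\<^bsub>V\<^esub> (?r \<otimes>\<^bsub>K\<^esub> c \<oplus>\<^bsub>K\<^esub> a) \<odot>\<^bsub>V\<^esub> v"
      using eval_snoc[OF p a c] by (simp add: eq)
    also have "\<dots> = (c \<odot>\<^bsub>V\<^esub> T (?h q) \<oplus>\<^bsub>V\<^esub> T (?h p)) \<oplus>\<^bsub>V\<^esub> (c \<odot>\<^bsub>V\<^esub> (?r \<odot>\<^bsub>V\<^esub> v) \<oplus>\<^bsub>V\<^esub> a \<odot>\<^bsub>V\<^esub> v)"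
      using hc c r a v by (simp add: T.f_add T.f_smult smult_l_distr smult_assoc1 R.m_comm)
    also have "\<dots> = c \<odot>\<^bsub>V\<^esub> ?h (q @ [?r]) \<oplus>\<^bsub>V\<^esub> ?h (p @ [a])"
      using hc c r a v by (simp add: smult_r_distr M.a_ac)
    finally show "T (?h (q @ [?r])) \<oplus>\<^bsub>V\<^esub> eval (p @ [a]) c \<odot>\<^bsub>V\<^esub> v
        = c \<odot>\<^bsub>V\<^esub> ?h (q @ [?r]) \<oplus>\<^bsub>V\<^esub> ?h (p @ [a])" .
  qed
qed

text \<open>Expands Horner's scheme into powers of \<open>T\<close>. The start value
  \<open>u\<close> is arbitrary because each induction step absorbs the leading coefficient into
  it.\<close>

lemma foldl_horner_map_rev:
  assumes T: "T \<in> module_hom K V V" and v: "v \<in> carrier V" and b: "b \<in> UNIV \<rightarrow> carrier K"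
    and "u \<in> carrier V"
  shows "foldl (\<lambda>u a. T u \<oplus>\<^bsub>V\<^esub> a \<odot>\<^bsub>V\<^esub> v) u (map b (rev [0..<n]))
    = (T ^^ n) u \<oplus>\<^bsub>V\<^esub> (\<Oplus>\<^bsub>V\<^esub>i \<in> {..<n}. b i \<odot>\<^bsub>V\<^esub> (T ^^ i) v)"
  using assms(4)
proof (induction n arbitrary: u)
  case 0
  then show ?case by simp
next
  case (Suc n)
  interpret T: mod_hom K V V T by unfold_locales (rule T)
  have b': "b i \<in> carrier K" for i using b by auto
  have cl: "(T ^^ i) w \<in> carrier V" if "w \<in> carrier V" for i w
    using that by (intro funpow_closed) auto
  have lin: "(T ^^ n) (x \<oplus>\<^bsub>V\<^esub> a \<odot>\<^bsub>V\<^esub> y) = (T ^^ n) x \<oplus>\<^bsub>V\<^esub> a \<odot>\<^bsub>V\<^esub> (T ^^ n) y"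
    if "x \<in> carrier V" "y \<in> carrier V" "a \<in> carrier K" for x y a
    using that by (induction n) (auto simp: T.f_add T.f_smult cl)
  have "(\<Oplus>\<^bsub>V\<^esub>i \<in> {..<n}. b i \<odot>\<^bsub>V\<^esub> (T ^^ i) v) \<in> carrier V"
    using b' cl v by (intro M.finsum_closed) auto
  then show ?case
    using Suc.IH[of "T u \<oplus>\<^bsub>V\<^esub> b n \<odot>\<^bsub>V\<^esub> v"] Suc.prems v b' cl
    by (simp add: lin lessThan_Suc funpow_swap1 M.a_assoc)
qed

end

text \<open>Take a shortest nonzero polynomial \<open>p\<close> with \<open>p(T) v = 0\<close> and a
  root \<open>c\<close> of it. Then \<open>p = (X - c) q\<close>, and \<open>q(T) v\<close> is an
  eigenvector, nonzero by minimality. One relation among the iterates of \<open>v\<close> replaces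
  finite-dimensionality of \<open>V\<close>.\<close>

lemma eigenvector_exists:
  assumes "algebraically_closed K" "vectorspace K V"
    and T: "T \<in> module_hom K V V" and v: "v \<in> carrier V" "v \<noteq> \<zero>\<^bsub>V\<^esub>"
    and b: "b \<in> UNIV \<rightarrow> carrier K" "(T ^^ n) v = (\<Oplus>\<^bsub>V\<^esub>i \<in> {..<n}. b i \<odot>\<^bsub>V\<^esub> (T ^^ i) v)"
  shows "\<exists>c \<in> carrier K. \<exists>u \<in> carrier V. u \<noteq> \<zero>\<^bsub>V\<^esub> \<and> T u = c \<odot>\<^bsub>V\<^esub> u"
proof -
  interpret K: algebraically_closed K by fact
  interpret vectorspace K V by fact
  interpret T: mod_hom K V V T by unfold_locales (rule T)
  let ?h = "horner V T v"
  define annihilates where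
    "annihilates p \<longleftrightarrow> set p \<subseteq> carrier K \<and> p \<noteq> [] \<and> hd p \<noteq> \<zero>\<^bsub>K\<^esub> \<and> ?h p = \<zero>\<^bsub>V\<^esub>" for p
  have b': "b i \<in> carrier K" for i using b by auto
  have cl: "(T ^^ i) v \<in> carrier V" for i
    using v by (intro funpow_closed) auto
  \<comment> \<open>The given relation as the monic polynomial \<open>X^n - ... - b 0\<close>. Its
    leading coefficient one turns the start value of the fold into \<open>v\<close>.\<close>
  have "?h (\<one>\<^bsub>K\<^esub> # map (\<lambda>i. \<ominus>\<^bsub>K\<^esub> b i) (rev [0..<n]))
      = (T ^^ n) v \<oplus>\<^bsub>V\<^esub> (\<Oplus>\<^bsub>V\<^esub>i \<in> {..<n}. (\<ominus>\<^bsub>K\<^esub> b i) \<odot>\<^bsub>V\<^esub> (T ^^ i) v)"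
    using foldl_horner_map_rev[OF T v(1), of "\<lambda>i. \<ominus>\<^bsub>K\<^esub> b i" v n] b' v by (simp add: horner_def)
  also have "\<dots> = (\<Oplus>\<^bsub>V\<^esub>i \<in> {..<n}. b i \<odot>\<^bsub>V\<^esub> (T ^^ i) v \<oplus>\<^bsub>V\<^esub> (\<ominus>\<^bsub>K\<^esub> b i) \<odot>\<^bsub>V\<^esub> (T ^^ i) v)"
    using b' cl by (simp add: b(2) M.finsum_addf)
  also have "\<dots> = \<zero>\<^bsub>V\<^esub>"
    using b' cl by (intro M.add.finprod_one_eqI) (simp add: smult_l_minus M.r_neg)
  finally have "annihilates (\<one>\<^bsub>K\<^esub> # map (\<lambda>i. \<ominus>\<^bsub>K\<^esub> b i) (rev [0..<n]))"
    using b' by (auto simp: annihilates_def)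
  then obtain p where p: "annihilates p" and min: "\<And>q. annihilates q \<Longrightarrow> length p \<le> length q"
    using ex_has_least_nat[of annihilates _ length] by blast
  have pc: "set p \<subseteq> carrier K" "p \<noteq> []" "hd p \<noteq> \<zero>\<^bsub>K\<^esub>" "?h p = \<zero>\<^bsub>V\<^esub>"
    using p by (auto simp: annihilates_def)
  \<comment> \<open>A nonzero constant cannot annihilate the nonzero \<open>v\<close>, so
    \<open>p\<close> has a root.\<close>
  have "length p \<noteq> 1"
  proof
    assume "length p = 1"
    then obtain a where "p = [] @ [a]" by (cases p) auto
    then have "a \<in> carrier K" "a \<noteq> \<zero>\<^bsub>K\<^esub>" "a \<odot>\<^bsub>V\<^esub> v = \<zero>\<^bsub>V\<^esub>"
      using pc v by (auto simp: horner_def)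
    then have "v = inv\<^bsub>K\<^esub> a \<odot>\<^bsub>V\<^esub> \<zero>\<^bsub>V\<^esub>"
      using mult_inverse[of a v "\<zero>\<^bsub>V\<^esub>"] v by simp
    then show False
      using v \<open>a \<in> carrier K\<close> \<open>a \<noteq> \<zero>\<^bsub>K\<^esub>\<close> K.field_Units by (simp add: K.Units_inv_closed)
  qed
  with pc obtain c where c: "c \<in> carrier K" "K.eval p c = \<zero>\<^bsub>K\<^esub>"
    using K.exists_root by blast
  obtain q where q: "set q \<subseteq> carrier K" "length q = length p - 1" "q \<noteq> [] \<longrightarrow> hd q = hd p"
    and eq: "T (?h q) \<oplus>\<^bsub>V\<^esub> K.eval p c \<odot>\<^bsub>V\<^esub> v = c \<odot>\<^bsub>V\<^esub> ?h q \<oplus>\<^bsub>V\<^esub> ?h p"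
    using horner_synthetic_division[OF T v(1) c(1) pc(1,2)] by blast
  have hq: "?h q \<in> carrier V"
    using T v q by (intro horner_closed)
  have "q \<noteq> []"
    using q(2) \<open>length p \<noteq> 1\<close> pc(2) by (cases p) auto
  \<comment> \<open>\<open>q\<close> is shorter than \<open>p\<close> and has the same nonzero
    leading coefficient, so it cannot annihilate \<open>v\<close>.\<close>
  then have "?h q \<noteq> \<zero>\<^bsub>V\<^esub>"
    using min[of q] q pc by (cases p) (auto simp: annihilates_def)
  moreover have "T (?h q) = c \<odot>\<^bsub>V\<^esub> ?h q"
    using eq c hq pc v by simp
  ultimately show ?thesis
    using c hq by blast
qed

section \<open>Homomorphisms of representations\<close>

text \<open>Unlike in \<open>hom_sum\<close> from the library, the index set need not consist of elements of the module.\<close>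

lemma (in mod_hom) hom_finsum:
  assumes "g \<in> A \<rightarrow> carrier M"
  shows "f (\<Oplus>\<^bsub>M\<^esub>i \<in> A. g i) = (\<Oplus>\<^bsub>N\<^esub>i \<in> A. f (g i))"
  using assms
proof (induction A rule: infinite_finite_induct)
  case (insert i A)
  then have "(\<Oplus>\<^bsub>N\<^esub>i \<in> insert i A. f (g i)) = f (g i) \<oplus>\<^bsub>N\<^esub> (\<Oplus>\<^bsub>N\<^esub>i \<in> A. f (g i))"
    by (intro N.M.finsum_insert) auto
  with insert show ?case
    by (simp add: f_add)
qed auto

section \<open>Equivariant linear maps as linear maps over the group algebra\<close>

lemma rep_homD:
  assumes "f \<in> rep_hom F G V \<rho> W \<tau>"
  shows "f \<in> module_hom F V W" "f \<in> extensional (carrier V)"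
    "g \<in> carrier G \<Longrightarrow> v \<in> carrier V \<Longrightarrow> f (\<rho> g v) = \<tau> g (f v)"
  using assms by (auto simp: rep_hom_def)

lemma rep_hom_closed: "f \<in> rep_hom F G V \<rho> W \<tau> \<Longrightarrow> v \<in> carrier V \<Longrightarrow> f v \<in> carrier W"
  by (auto simp: rep_hom_def module_hom_def)

lemma (in group_representation) compose_rep_hom:
  assumes "f \<in> rep_hom F G V \<rho> W \<tau>" "h \<in> rep_hom F G W \<tau> U \<upsilon>"
  shows "compose (carrier V) h f \<in> rep_hom F G V \<rho> U \<upsilon>"
  using assms by (auto simp: rep_hom_def module_hom_def compose_def rho_closed Pi_def)

text \<open>An element of the group algebra acts as a finite linear combination of group elements,
  and an equivariant linear map commutes with each term.\<close>

lemma rep_hom_imp_module_hom: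
  assumes "group_representation F G V \<rho>" "group_representation F G W \<tau>"
    and f: "f \<in> rep_hom F G V \<rho> W \<tau>"
  shows "f \<in> module_hom (group_algebra F G) (rep_module F G V \<rho>) (rep_module F G W \<tau>)"
proof -
  interpret V: group_representation F G V \<rho> by fact
  interpret W: group_representation F G W \<tau> by fact
  interpret f: mod_hom F V W f
    by unfold_locales (rule rep_homD(1)[OF f])
  have "f (gsum F G V a (\<lambda>g. \<rho> g v)) = gsum F G W a (\<lambda>g. \<tau> g (f v))"
    if "a \<in> carrier (group_algebra F G)" "v \<in> carrier V" for a v
  proof -
    note a = group_algebra_carrierD[OF that(1)]
    have "f (gsum F G V a (\<lambda>g. \<rho> g v)) = (\<Oplus>\<^bsub>W\<^esub>g \<in> gsupp F G a. f (a g \<odot>\<^bsub>V\<^esub> \<rho> g v))"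
      using a that by (subst f.hom_finsum) (auto simp: gsupp_def V.rho_closed Pi_def comp_def)
    also have "\<dots> = gsum F G W a (\<lambda>g. \<tau> g (f v))"
      using a that
      by (intro W.M.finsum_cong')
         (auto simp: gsupp_def Pi_def V.rho_closed W.rho_closed f.f_smult rep_homD(3)[OF f])
    finally show ?thesis .
  qed
  then show ?thesis
    by (auto simp: module_hom_def rep_module_def f.f_add)
qed

text \<open>The one-term formal sum \<open>a g\<close>. Taking \<open>g\<close> to be the identity
  gives the scalars, and taking \<open>a\<close> to be one gives the group elements.\<close>

definition group_algebra_single ::
    "('f, 'a) ring_scheme \<Rightarrow> ('g, 'b) monoid_scheme \<Rightarrow> 'f \<Rightarrow> 'g \<Rightarrow> 'g \<Rightarrow> 'f"
  where "group_algebra_single F G a g = (\<lambda>x \<in> carrier G. if x = g then a else \<zero>\<^bsub>F\<^esub>)"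

lemma (in group_representation) smult_group_algebra_single:
  assumes "a \<in> carrier F" "g \<in> carrier G" "v \<in> carrier V"
  shows "group_algebra_single F G a g \<in> carrier (group_algebra F G)"
    "group_algebra_single F G a g \<odot>\<^bsub>rep_module F G V \<rho>\<^esub> v = a \<odot>\<^bsub>V\<^esub> \<rho> g v"
proof -
  let ?s = "group_algebra_single F G a g"
  have val: "?s \<in> carrier G \<rightarrow> carrier F"
    using assms(1) by (auto simp: group_algebra_single_def)
  have sub: "gsupp F G ?s \<subseteq> {g}"
    by (auto simp: gsupp_def group_algebra_single_def split: if_splits)
  with assms(1) show "?s \<in> carrier (group_algebra F G)"
    by (auto simp: group_algebra_def group_algebra_single_def intro: finite_subset)
  have "gsum F G V ?s (\<lambda>g. \<rho> g v) = (\<Oplus>\<^bsub>V\<^esub>y \<in> {g}. ?s y \<odot>\<^bsub>V\<^esub> \<rho> y v)"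
    using assms sub val by (intro finsum_gsupp module_axioms) (auto simp: rho_closed)
  also have "\<dots> = a \<odot>\<^bsub>V\<^esub> \<rho> g v"
    using assms by (simp add: rho_closed group_algebra_single_def)
  finally show "?s \<odot>\<^bsub>rep_module F G V \<rho>\<^esub> v = a \<odot>\<^bsub>V\<^esub> \<rho> g v"
    by (simp add: rep_module_def)
qed

text \<open>Testing on one-term formal sums \<open>a g\<close> gives linearity when \<open>g\<close>
  is the identity and equivariance when \<open>a\<close> is one. The restriction provides the
  extensionality that \<open>rep_hom\<close> demands.\<close>

lemma module_hom_imp_rep_hom:
  assumes "group_representation F G V \<rho>" "group_representation F G W \<tau>"
    and f: "f \<in> module_hom (group_algebra F G) (rep_module F G V \<rho>) (rep_module F G W \<tau>)"
  shows "restrict f (carrier V) \<in> rep_hom F G V \<rho> W \<tau>"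
proof -
  interpret V: group_representation F G V \<rho> by fact
  interpret W: group_representation F G W \<tau> by fact
  interpret G: group G by (rule V.group_G)
  have c: "f v \<in> carrier W" if "v \<in> carrier V" for v
    using f that by (auto simp: module_hom_def rep_module_def)
  have single: "f (a \<odot>\<^bsub>V\<^esub> \<rho> g v) = a \<odot>\<^bsub>W\<^esub> \<tau> g (f v)"
    if "a \<in> carrier F" "g \<in> carrier G" "v \<in> carrier V" for a g v
  proof -
    let ?s = "group_algebra_single F G a g"
    have "f (?s \<odot>\<^bsub>rep_module F G V \<rho>\<^esub> v) = ?s \<odot>\<^bsub>rep_module F G W \<tau>\<^esub> f v"
      using module_hom_smult[OF f V.smult_group_algebra_single(1)[OF that]] that
      by (simp add: rep_module_def)
    then show ?thesis
      by (simp only: V.smult_group_algebra_single(2)[OF that]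
          W.smult_group_algebra_single(2)[OF that(1,2) c[OF that(3)]])
  qed
  have "f (a \<odot>\<^bsub>V\<^esub> v) = a \<odot>\<^bsub>W\<^esub> f v" if "a \<in> carrier F" "v \<in> carrier V" for a v
    using single[OF that(1) G.one_closed that(2)] that c by (simp add: V.rho_one W.rho_one)
  moreover have "f (\<rho> g v) = \<tau> g (f v)" if "g \<in> carrier G" "v \<in> carrier V" for g v
    using single[OF V.R.one_closed that] that c by (simp add: V.rho_closed W.rho_closed)
  moreover have "f (v \<oplus>\<^bsub>V\<^esub> w) = f v \<oplus>\<^bsub>W\<^esub> f w" if "v \<in> carrier V" "w \<in> carrier V" for v w
    using f that by (auto simp: module_hom_def rep_module_def)
  ultimately show ?thesis
    using c by (auto simp: rep_hom_def module_hom_def V.rho_closed)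
qed

section \<open>Maps out of an irreducible representation and the space they form\<close>

text \<open>The injectivity half of Schur's lemma: the kernel is an invariant subspace that misses
  \<open>v\<close>, so irreducibility forces it to be zero.\<close>

lemma irreducible_rep_hom_inj_on:
  assumes irr: "irreducible_representation F G V \<rho>" and "group_representation F G W \<tau>"
    and f: "f \<in> rep_hom F G V \<rho> W \<tau>" and v: "v \<in> carrier V" "f v \<noteq> \<zero>\<^bsub>W\<^esub>"
  shows "inj_on f (carrier V)"
proof -
  interpret V: group_representation F G V \<rho>
    using irr by (simp add: irreducible_representation_def)
  interpret W: group_representation F G W \<tau> by fact
  interpret f: linear_map F V W f
    by unfold_locales (rule rep_homD(1)[OF f])
  have "\<tau> g \<zero>\<^bsub>W\<^esub> = \<zero>\<^bsub>W\<^esub>" if "g \<in> carrier G" for g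
    using W.rho_finsum[OF that, of "{}" "\<lambda>_. \<zero>\<^bsub>W\<^esub>"] by simp
  then have "\<forall>g \<in> carrier G. \<rho> g ` f.ker \<subseteq> f.ker"
    by (auto simp: f.ker_def V.rho_closed rep_homD(3)[OF f])
  then have "f.ker = {\<zero>\<^bsub>V\<^esub>} \<or> f.ker = carrier V"
    using irr f.kerT_is_subspace unfolding irreducible_representation_def by blast
  then have "f.ker = {\<zero>\<^bsub>V\<^esub>}"
    using v by (auto simp: f.ker_def)
  then show ?thesis
    using f.Ke0_imp_inj by simp
qed

lemma rep_hom_eqI:
  assumes "f \<in> rep_hom F G V \<rho> W \<tau>" "h \<in> rep_hom F G V \<rho> W \<tau>"
    and "\<And>v. v \<in> carrier V \<Longrightarrow> f v = h v"
  shows "f = h"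
  using assms rep_homD(2) extensionalityI by metis

lemma rep_hom_space_simps:
  "carrier (rep_hom_space F G V \<rho> W \<tau>) = rep_hom F G V \<rho> W \<tau>"
  "v \<in> carrier V \<Longrightarrow> (f \<oplus>\<^bsub>rep_hom_space F G V \<rho> W \<tau>\<^esub> h) v = f v \<oplus>\<^bsub>W\<^esub> h v"
  "v \<in> carrier V \<Longrightarrow> (a \<odot>\<^bsub>rep_hom_space F G V \<rho> W \<tau>\<^esub> f) v = a \<odot>\<^bsub>W\<^esub> f v"
  "v \<in> carrier V \<Longrightarrow> \<zero>\<^bsub>rep_hom_space F G V \<rho> W \<tau>\<^esub> v = \<zero>\<^bsub>W\<^esub>"
  by (simp_all add: rep_hom_space_def)

text \<open>A single vector spans. It may be zero, so the zero space is covered too.\<close>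

lemma (in vectorspace) dim_le_one:
  assumes "v \<in> carrier V" "\<And>w. w \<in> carrier V \<Longrightarrow> \<exists>a \<in> carrier K. w = a \<odot>\<^bsub>V\<^esub> v"
  shows "fin_dim" "dim \<le> 1"
proof -
  have in_span: "w \<in> span {v}" if "w \<in> carrier V" for w
  proof -
    obtain a where a: "a \<in> carrier K" "w = a \<odot>\<^bsub>V\<^esub> v"
      using assms(2) \<open>w \<in> carrier V\<close> by blast
    then have "w = lincomb (\<lambda>_. a) {v}"
      using assms(1) by (simp add: lincomb_def)
    with a(1) show ?thesis
      by (auto simp: span_def)
  qed
  then have gen: "gen_set {v}"
    using span_is_subset2[of "{v}"] in_span assms(1) by auto
  then show "fin_dim"
    unfolding fin_dim_def using assms(1) by (intro exI[of _ "{v}"]) auto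
  show "dim \<le> 1"
    using gen_ge_dim[of "{v}"] gen assms(1) by simp
qed

section \<open>Multiplicity-freeness from self-injectivity and commuting endomorphisms\<close>

theorem theorem1p7:
  fixes F :: "'f ring" and G :: "'g monoid" and V :: "('f, 'v) module"
    and \<rho> :: "'g \<Rightarrow> 'v \<Rightarrow> 'v"
  assumes "algebraically_closed F"
    and "finitely_generated_group G"
    and "group_representation F G V \<rho>"
    and "vectorspace.fin_dim F V"
    and "\<forall>f \<in> rep_end F G V \<rho>. \<forall>h \<in> rep_end F G V \<rho>.
           compose (carrier V) f h = compose (carrier V) h f"
    and "self_injective (group_algebra F G) (rep_module F G V \<rho>)"
  shows "multiplicity_free TYPE('w) F G V \<rho>"
  unfolding multiplicity_free_def
proof (intro allI impI)
  fix W :: "('f, 'w) module" and \<pi>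
  assume irr: "irreducible_representation F G W \<pi>"
  then have rW: "group_representation F G W \<pi>"
    by (simp add: irreducible_representation_def)
  interpret V: group_representation F G V \<rho> by fact
  interpret W: group_representation F G W \<pi> by fact
  let ?H = "rep_hom_space F G W \<pi> V \<rho>"
  interpret H: vectorspace F ?H
    by (rule vectorspace_rep_hom_space) fact+
  note H_simps = rep_hom_space_simps[where F = F and G = G and V = W and \<rho> = \<pi> and W = V and \<tau> = \<rho>]
  note H_eqI = rep_hom_eqI[where F = F and G = G and V = W and \<rho> = \<pi> and W = V and \<tau> = \<rho>]
  have H_closed: "f w \<in> carrier V" if "f \<in> carrier ?H" "w \<in> carrier W" for f w
    using that rep_hom_closed unfolding H_simps by metis
  have H_inj: "inj_on f (carrier W)" if "f \<in> carrier ?H" "f \<noteq> \<zero>\<^bsub>?H\<^esub>" for f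
  proof -
    from that obtain w where "w \<in> carrier W" "f w \<noteq> \<zero>\<^bsub>V\<^esub>"
      using H_eqI[of f "\<zero>\<^bsub>?H\<^esub>"] H.M.zero_closed by (auto simp: H_simps)
    then show ?thesis
      using irreducible_rep_hom_inj_on[OF irr V.group_representation_axioms] that by (simp add: H_simps)
  qed
  \<comment> \<open>Self-injectivity extends \<open>f'\<close> along the embedding \<open>f\<close>
    of \<open>W\<close> into \<open>V\<close>.\<close>
  have transitive: "\<exists>e \<in> rep_end F G V \<rho>. compose (carrier W) e f = f'"
    if f: "f \<in> carrier ?H" "f \<noteq> \<zero>\<^bsub>?H\<^esub>" and f': "f' \<in> carrier ?H" for f f'
  proof -
    let ?A = "group_algebra F G"
    let ?V = "rep_module F G V \<rho>" and ?W = "rep_module F G W \<pi>"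
    have "f \<in> module_hom ?A ?W ?V" "f' \<in> module_hom ?A ?W ?V" "inj_on f (carrier ?W)"
      using f f' H_inj[OF f] rep_hom_imp_module_hom[OF rW assms(3)]
      by (auto simp: H_simps rep_module_def)
    \<comment> \<open>\<open>W\<close> and \<open>V\<close> may have different element types, hence
      \<open>injective_relative_toD\<close> rather than the bare definition.\<close>
    with assms(6) obtain e where e: "e \<in> module_hom ?A ?V ?V" "\<forall>x \<in> carrier ?W. e (f x) = f' x"
      unfolding self_injective_def
      by (metis injective_relative_toD V.left_module_rep_module W.left_module_rep_module)
    have e': "restrict e (carrier V) \<in> rep_end F G V \<rho>"
      using module_hom_imp_rep_hom[OF assms(3,3) e(1)] .
    have "compose (carrier W) (restrict e (carrier V)) f = f'"
      using e(2) f' H_closed[OF f(1)] W.compose_rep_hom[OF _ e', of f] f(1)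
      by (intro H_eqI) (auto simp: H_simps compose_def rep_module_def)
    with e' show ?thesis by blast
  qed
  have proportional: "\<exists>c \<in> carrier F. f' = c \<odot>\<^bsub>?H\<^esub> f"
    if f: "f \<in> carrier ?H" "f \<noteq> \<zero>\<^bsub>?H\<^esub>" and f': "f' \<in> carrier ?H" for f f'
  proof -
    obtain h where h: "h \<in> rep_end F G V \<rho>" "compose (carrier W) h f = f'"
      using transitive[OF f f'] by blast
    interpret h: mod_hom F V V h
      by unfold_locales (rule rep_homD(1)[OF h(1)])
    \<comment> \<open>Left multiplication by \<open>h\<close> on \<open>?H\<close>, the operator
      whose eigenvector is sought.\<close>
    let ?T = "compose (carrier W) h"
    have Tc: "?T k \<in> carrier ?H" if "k \<in> carrier ?H" for k
      using W.compose_rep_hom[OF _ h(1)] that by (simp add: H_simps)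
    have T: "?T \<in> module_hom F ?H ?H"
      unfolding module_hom_def
    proof (intro CollectI conjI allI impI; (elim conjE)?)
      fix k l assume kl: "k \<in> carrier ?H" "l \<in> carrier ?H"
      then show "?T (k \<oplus>\<^bsub>?H\<^esub> l) = ?T k \<oplus>\<^bsub>?H\<^esub> ?T l"
        using Tc by (intro H_eqI; (unfold H_simps(1)[symmetric])?)
          (auto simp: H_simps(2-) compose_def H_closed h.f_add)
    next
      fix a k assume ak: "a \<in> carrier F" "k \<in> carrier ?H"
      then show "?T (a \<odot>\<^bsub>?H\<^esub> k) = a \<odot>\<^bsub>?H\<^esub> ?T k"
        using Tc by (intro H_eqI; (unfold H_simps(1)[symmetric])?)
          (auto simp: H_simps(2-) compose_def H_closed h.f_smult)
    qed (use Tc in auto)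
    obtain w where w: "w \<in> carrier W" "w \<noteq> \<zero>\<^bsub>W\<^esub>"
      using irr W.M.zero_closed unfolding irreducible_representation_def by blast
    have ev: "mod_hom F ?H V (\<lambda>k. k w)"
      using w by unfold_locales (auto simp: module_hom_def H_closed H_simps(2-))
    \<comment> \<open>A nonzero \<open>k\<close> is injective and cannot kill \<open>w\<close>, so
      evaluation at \<open>w\<close> embeds \<open>?H\<close> into \<open>V\<close>.\<close>
    have ev0: "k = \<zero>\<^bsub>?H\<^esub>" if "k \<in> carrier ?H" "k w = \<zero>\<^bsub>V\<^esub>" for k
    proof (rule ccontr)
      assume "k \<noteq> \<zero>\<^bsub>?H\<^esub>"
      interpret k: mod_hom F W V k
        using that by unfold_locales (auto simp: H_simps dest: rep_homD(1))
      show False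
        using H_inj[OF that(1) \<open>k \<noteq> \<zero>\<^bsub>?H\<^esub>\<close>] w that(2) inj_onD[of k "carrier W" w "\<zero>\<^bsub>W\<^esub>"] by simp
    qed
    interpret ev: mod_hom F ?H V "\<lambda>k. k w" by (rule ev)
    have Tpow: "(?T ^^ i) f \<in> carrier ?H" for i
      using Tc f(1) by (intro H.funpow_closed) auto
    \<comment> \<open>The relation is found among values in \<open>V\<close>, whose dimension is
      known to be finite, and then lifted to \<open>?H\<close> by injectivity of evaluation.\<close>
    obtain n b where b: "b \<in> UNIV \<rightarrow> carrier F"
      and eq: "(?T ^^ n) f w = (\<Oplus>\<^bsub>V\<^esub>i \<in> {..<n}. b i \<odot>\<^bsub>V\<^esub> (?T ^^ i) f w)"
      using V.sequence_dependent[OF assms(4), of "\<lambda>i. (?T ^^ i) f w"] H_closed[OF Tpow w(1)] by blast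
    let ?s = "\<Oplus>\<^bsub>?H\<^esub>i \<in> {..<n}. b i \<odot>\<^bsub>?H\<^esub> (?T ^^ i) f"
    have b': "b i \<in> carrier F" for i using b by auto
    have s: "?s \<in> carrier ?H"
      using b' Tpow by (intro H.M.finsum_closed) auto
    have "?s w = (\<Oplus>\<^bsub>V\<^esub>i \<in> {..<n}. (b i \<odot>\<^bsub>?H\<^esub> (?T ^^ i) f) w)"
      using ev.hom_finsum[of "\<lambda>i. b i \<odot>\<^bsub>?H\<^esub> (?T ^^ i) f"] b' Tpow by (auto simp: comp_def)
    also have "\<dots> = (?T ^^ n) f w"
      using w by (simp add: eq H_simps(3))
    finally have "((?T ^^ n) f \<ominus>\<^bsub>?H\<^esub> ?s) w = \<zero>\<^bsub>V\<^esub>"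
      using Tpow s ev.f_minus[of "(?T ^^ n) f" ?s] H_closed[OF Tpow w(1)]
      by (simp add: V.M.minus_eq V.M.r_neg)
    then have "(?T ^^ n) f \<ominus>\<^bsub>?H\<^esub> ?s = \<zero>\<^bsub>?H\<^esub>"
      using Tpow s by (intro ev0) auto
    then have "(?T ^^ n) f = ?s"
      using Tpow s by simp
    then obtain c u where c: "c \<in> carrier F" and u: "u \<in> carrier ?H" "u \<noteq> \<zero>\<^bsub>?H\<^esub>"
      and Tu: "?T u = c \<odot>\<^bsub>?H\<^esub> u"
      using eigenvector_exists[OF assms(1) H.vectorspace_axioms T f b] by blast
    \<comment> \<open>Writing \<open>f\<close> as \<open>e u\<close> transfers the eigenvalue from
      \<open>u\<close> to \<open>f\<close>: \<open>h e u = e h u = e (c u) = c (e u)\<close>, the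
      first equality by commutativity.\<close>
    obtain e where e: "e \<in> rep_end F G V \<rho>" "compose (carrier W) e u = f"
      using transitive[OF u f(1)] by blast
    have "f' x = (c \<odot>\<^bsub>?H\<^esub> f) x" if x: "x \<in> carrier W" for x
    proof -
      have comm: "h (e y) = e (h y)" if "y \<in> carrier V" for y
        using assms(5)[rule_format, OF h(1) e(1)] that by (metis compose_eq)
      have "f' x = h (e (u x))"
        using x by (simp add: h(2)[symmetric] e(2)[symmetric] compose_eq)
      also have "\<dots> = e (h (u x))"
        by (rule comm[OF H_closed[OF u(1) x]])
      also have "h (u x) = c \<odot>\<^bsub>V\<^esub> u x"
        using fun_cong[OF Tu, of x] x by (simp add: compose_eq H_simps(3))
      also have "e (c \<odot>\<^bsub>V\<^esub> u x) = c \<odot>\<^bsub>V\<^esub> e (u x)"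
        using module_hom_smult[OF rep_homD(1)[OF e(1)] c] H_closed[OF u(1) x] .
      also have "\<dots> = (c \<odot>\<^bsub>?H\<^esub> f) x"
        using x by (simp add: H_simps(3) e(2)[symmetric] compose_eq)
      finally show ?thesis .
    qed
    then have "f' = c \<odot>\<^bsub>?H\<^esub> f"
      using f f' c H.smult_closed[OF c f(1)] by (intro H_eqI) (auto simp: H_simps(1))
    with c show ?thesis by blast
  qed
  \<comment> \<open>The spanning vector is zero if \<open>?H\<close> is trivial, and otherwise any
    nonzero element.\<close>
  have "\<exists>f \<in> carrier ?H. \<forall>f' \<in> carrier ?H. \<exists>c \<in> carrier F. f' = c \<odot>\<^bsub>?H\<^esub> f"
  proof (cases "carrier ?H = {\<zero>\<^bsub>?H\<^esub>}")
    case True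
    then show ?thesis by (auto intro!: bexI[of _ "\<zero>\<^bsub>F\<^esub>"])
  next
    case False
    then obtain f where "f \<in> carrier ?H" "f \<noteq> \<zero>\<^bsub>?H\<^esub>"
      using H.M.zero_closed by blast
    with proportional show ?thesis by blast
  qed
  then show "H.fin_dim \<and> H.dim \<le> 1"
    using H.dim_le_one by blast
qed

end
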